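(* Let $-A$ be the generator of a $C_0$-semigroup $(T(t))_{t\ge0}$ on a Banach space $X$ such that $\mathbb{C}_-\subseteq\rho(A)$, and set $M:=\sup\{\|T(t)\|_{\mathcal{L}(X)}: t\in[0,2]\}$. Suppose that there exists a nondecreasing $g:(0,\infty)\to(0,\infty)$ such that $$\|(\lambda+A)^{-1}\|_{\mathcal{L}(X)}\le g(\mathrm{Re}(\lambda)^{-1})\qquad(\lambda\in\mathbb{C}_+).$$ Then for each $\gamma\in(1,\infty)$ there exists a $C_\gamma>0$ such that $\|T(t)\|_{\mathcal{L}(X_\gamma,X)}\le C_\gamma g(t)+M$ for all $t>0$.
   Context: Banach spaces are nonzero and over $\mathbb{C}$; $\mathcal{L}(Y,X)$ denotes the bounded operators from $Y$ to $X$, and $\mathcal{L}(X)=\mathcal{L}(X,X)$. $\mathbb{C}_+=\{\mathrm{Re}(\lambda)>0\}$, $\mathbb{C}_-=-\mathbb{C}_+$; $\rho(A)$ is the resolvent set. For $\gamma\in[0,\infty)$, $X_\gamma:=D((\omega+A)^\gamma)$ is the fractional domain, with the graph norm $\|x\|_X+\|(\omega+A)^\gamma x\|_X$, where $\omega$ is any fixed real number larger than the growth bound $\omega_0(T)$, so that $\omega+A$ is a sectorial operator; up to equivalence of norms $X_\gamma$ does not depend on $\omega$. *)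

theory Defs
  imports "HOL-Analysis.Analysis"
begin

class complex_banach = banach +
  fixes scaleC :: "complex \<Rightarrow> 'a \<Rightarrow> 'a"  (infixr \<open>*\<^sub>C\<close> 75)
  assumes scaleC_add_right: "c *\<^sub>C (x + y) = c *\<^sub>C x + c *\<^sub>C y"
    and scaleC_add_left: "(c + d) *\<^sub>C x = c *\<^sub>C x + d *\<^sub>C x"
    and scaleC_scaleC: "c *\<^sub>C (d *\<^sub>C x) = (c * d) *\<^sub>C x"
    and scaleC_of_real: "complex_of_real r *\<^sub>C x = r *\<^sub>R x"
    and norm_scaleC: "norm (c *\<^sub>C x) = norm c * norm x"

definition bounded_clinear :: "('a::complex_banach \<Rightarrow> 'a) \<Rightarrow> bool" where
  "bounded_clinear f \<longleftrightarrow> bounded_linear f \<and> (\<forall>c x. f (c *\<^sub>C x) = c *\<^sub>C f x)"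

text \<open>An unbounded operator \<open>B\<close> is a partial function, \<open>dom B\<close> being its domain.\<close>

definition op_uminus :: "('a::complex_banach \<rightharpoonup> 'a) \<Rightarrow> ('a \<rightharpoonup> 'a)" where
  "op_uminus B = (\<lambda>x. map_option uminus (B x))"

definition op_shift :: "complex \<Rightarrow> ('a::complex_banach \<rightharpoonup> 'a) \<Rightarrow> ('a \<rightharpoonup> 'a)" where
  "op_shift c B = (\<lambda>x. map_option (\<lambda>y. c *\<^sub>C x + y) (B x))"

text \<open>The inverse \<open>B\<^sup>-\<^sup>1\<close>; meaningful if \<open>B\<close> maps its domain bijectively onto the space.\<close>

definition op_inverse :: "('a::complex_banach \<rightharpoonup> 'a) \<Rightarrow> 'a \<Rightarrow> 'a" where
  "op_inverse B = inv_into (dom B) (\<lambda>x. the (B x))"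

definition op_invertible :: "('a::complex_banach \<rightharpoonup> 'a) \<Rightarrow> bool" where
  "op_invertible B \<longleftrightarrow>
     bij_betw (\<lambda>x. the (B x)) (dom B) UNIV \<and> bounded_clinear (op_inverse B)"

definition resolvent_set :: "('a::complex_banach \<rightharpoonup> 'a) \<Rightarrow> complex set" where
  "resolvent_set B = {c. op_invertible (op_shift (- c) B)}"

definition C0_semigroup :: "(real \<Rightarrow> 'a::complex_banach \<Rightarrow> 'a) \<Rightarrow> bool" where
  "C0_semigroup T \<longleftrightarrow>
     (\<forall>t\<ge>0. bounded_clinear (T t)) \<and>
     (\<forall>x. T 0 x = x) \<and>
     (\<forall>s\<ge>0. \<forall>t\<ge>0. \<forall>x. T (s + t) x = T s (T t x)) \<and>
     (\<forall>x. ((\<lambda>t. T t x) \<longlongrightarrow> x) (at_right 0))"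

definition generator :: "(real \<Rightarrow> 'a::complex_banach \<Rightarrow> 'a) \<Rightarrow> ('a \<rightharpoonup> 'a)" where
  "generator T = (\<lambda>x.
     if \<exists>y. ((\<lambda>h. (T h x - x) /\<^sub>R h) \<longlongrightarrow> y) (at_right 0)
     then Some (THE y. ((\<lambda>h. (T h x - x) /\<^sub>R h) \<longlongrightarrow> y) (at_right 0))
     else None)"

text \<open>The growth bound is extended-real valued since it may be \<open>-\<infinity>\<close>.\<close>

definition growth_bound :: "(real \<Rightarrow> 'a::complex_banach \<Rightarrow> 'a) \<Rightarrow> ereal" where
  "growth_bound T =
     Inf {ereal w | w. \<exists>K\<ge>1. \<forall>t\<ge>0. onorm (T t) \<le> K * exp (w * t)}"

text \<open>
  Fractional powers of a sectorial operator \<open>B\<close> with \<open>0\<close> in its resolvent set, as for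
  \<open>B = \<omega> + A\<close> with \<open>-A\<close> generating a semigroup of growth bound less than \<open>\<omega>\<close>. For \<open>\<gamma> > 0\<close> and
  a natural number \<open>n > \<gamma>\<close>, the bounded operator \<open>B\<^sup>-\<^sup>\<gamma>\<close> is given by the Balakrishnan--Komatsu
  integral \<open>\<Gamma>(n) / (\<Gamma>(\<gamma>) \<Gamma>(n - \<gamma>)) \<integral>\<^sub>0\<^sup>\<infinity> t\<^sup>n\<^sup>-\<^sup>\<gamma>\<^sup>-\<^sup>1 (t + B)\<^sup>-\<^sup>n x dt\<close>, which is independent of \<open>n\<close>; here
  \<open>n = \<lfloor>\<gamma>\<rfloor> + 1\<close>. The operator \<open>B\<^sup>-\<^sup>\<gamma>\<close> is injective, and \<open>B\<^sup>\<gamma>\<close> is its inverse, with domain the range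
  of \<open>B\<^sup>-\<^sup>\<gamma>\<close>.
\<close>

definition neg_frac_power :: "('a::complex_banach \<rightharpoonup> 'a) \<Rightarrow> real \<Rightarrow> 'a \<Rightarrow> 'a" where
  "neg_frac_power B \<gamma> x = (let n = nat \<lfloor>\<gamma>\<rfloor> + 1 in
     (Gamma (real n) / (Gamma \<gamma> * Gamma (real n - \<gamma>))) *\<^sub>R
     integral {0<..} (\<lambda>t. t powr (real n - \<gamma> - 1) *\<^sub>R
       ((op_inverse (op_shift (complex_of_real t) B)) ^^ n) x))"

definition frac_power :: "('a::complex_banach \<rightharpoonup> 'a) \<Rightarrow> real \<Rightarrow> ('a \<rightharpoonup> 'a)" where
  "frac_power B \<gamma> = (\<lambda>x.
     if x \<in> range (neg_frac_power B \<gamma>) then Some (inv (neg_frac_power B \<gamma>) x) else None)"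

definition graph_norm :: "('a::complex_banach \<rightharpoonup> 'a) \<Rightarrow> 'a \<Rightarrow> real" where
  "graph_norm B x = norm x + norm (the (B x))"

text \<open>
  Norm of \<open>S\<close> as an operator from \<open>dom B\<close>, equipped with the graph norm, to the whole space. As in
  \<^const>\<open>onorm\<close>, the quotient at \<open>x = 0\<close> is \<open>0\<close>.
\<close>

definition onorm_dom :: "('a::complex_banach \<rightharpoonup> 'a) \<Rightarrow> ('a \<Rightarrow> 'a) \<Rightarrow> real" where
  "onorm_dom B S = (SUP x\<in>dom B. norm (S x) / graph_norm B x)"

end

theory Submission
  imports Defs
begin

text \<open>
  Let \<open>R z = (z + A)\<^sup>-\<^sup>1\<close>. For \<open>t \<le> 2\<close> the bound by \<open>M\<close> is immediate. For \<open>t > 2\<close> the idea is to represent the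
  semigroup by the inversion formula of the Laplace transform on the line \<open>Re z = 1 / t\<close>. On that line
  \<open>\<bar>exp (z t)\<bar> = e\<close> and \<open>norm (R z) \<le> g t\<close>, so the factor \<open>g t\<close> comes out, provided that the integral
  converges absolutely.

  Convergence is enforced by two additional resolvents. If \<open>\<sigma>\<close> lies to the right of the line, then
  \[ T(t) R(\sigma)^2 x = \frac{1}{2\pi i} \int_{Re\, z = 1/t} e^{zt} \frac{R(z) x}{(z - \sigma)^2} dz, \]
  and integrating \<open>1 / \<bar>z - \<sigma>\<bar>\<^sup>2\<close> over the line gives
  \<open>norm (T t (R \<sigma> (R \<sigma> x))) \<le> e / (2 (\<sigma> - 1 / t)) * g t * norm x\<close>, which is
  \<open>norm_T_resolvent_square_le\<close>. The line may lie to the left of the growth bound, so the formula is not a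
  consequence of \<open>R\<close> being the Laplace transform of \<open>T\<close>. Instead it is shown that the right-hand side is
  an orbit (\<open>T_V_0_near_V\<close>, by way of the identity \<open>exp_orbit_integral\<close>) that starts at \<open>R \<sigma> (R \<sigma> x)\<close>
  (\<open>V_0_near_square\<close>, a residue computation). All integrals are truncated at height \<open>N\<close>, hence integrals
  of continuous functions over compact intervals, and the error terms are controlled by shifting
  contours with \<open>vertical_integral_shift_bound\<close>.

  An element \<open>x\<close> of the domain of \<open>(\<omega> + A)\<^sup>\<gamma>\<close> is a multiple of the
  integral over \<open>s > 0\<close> of \<open>s\<^sup>n\<^sup>-\<^sup>\<gamma>\<^sup>-\<^sup>1 (s + \<omega> + A)\<^sup>-\<^sup>n y\<close> with
  \<open>y = (\<omega> + A)\<^sup>\<gamma> x\<close> and \<open>n = \<lfloor>\<gamma>\<rfloor> + 1\<close>. Two of the \<open>n\<close> resolvents are used as above, after a shift by a fixed amount that keeps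
  \<open>\<sigma>\<close> away from the line (\<open>op_inverse_square\<close>), the others are bounded as in the Hille-Yosida theorem
  (\<open>norm_op_inverse_power_le\<close>). Altogether \<open>T t\<close> applied to the integrand is bounded by a multiple of
  \<open>g t * norm y * s\<^sup>n\<^sup>-\<^sup>\<gamma>\<^sup>-\<^sup>1 / (1 + s)\<^sup>n\<^sup>-\<^sup>1\<close>, and this is integrable because \<open>\<gamma> > 1\<close>. Since \<open>\<omega>\<close> may be negative,
  the existence of these resolvents has to be extended beyond the right half-plane, which is
  \<open>shift_onto_right_of_growth\<close>.
\<close>

section \<open>Calculus in complex Banach spaces\<close>

lemma bounded_bilinear_scaleC: "bounded_bilinear ((*\<^sub>C) :: complex \<Rightarrow> 'a::complex_banach \<Rightarrow> 'a)"
proof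
  fix r :: real and c :: complex and x :: 'a
  show "(r *\<^sub>R c) *\<^sub>C x = r *\<^sub>R c *\<^sub>C x"
    by (simp add: scaleR_conv_of_real flip: scaleC_scaleC scaleC_of_real)
  show "c *\<^sub>C r *\<^sub>R x = r *\<^sub>R c *\<^sub>C x"
    by (simp add: scaleC_scaleC mult.commute flip: scaleC_of_real)
  show "\<exists>K. \<forall>(c::complex) (x::'a). norm (c *\<^sub>C x) \<le> norm c * norm x * K"
    by (rule exI[of _ 1]) (simp add: norm_scaleC)
qed (simp_all add: scaleC_add_left scaleC_add_right)

lemmas scaleC_minus_right = bounded_bilinear.minus_right[OF bounded_bilinear_scaleC]
lemmas scaleC_diff_left = bounded_bilinear.diff_left[OF bounded_bilinear_scaleC]
lemmas scaleC_diff_right = bounded_bilinear.diff_right[OF bounded_bilinear_scaleC]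
lemmas continuous_on_scaleC [continuous_intros] =
  bounded_bilinear.continuous_on[OF bounded_bilinear_scaleC]
lemmas bounded_linear_scaleC_left = bounded_bilinear.bounded_linear_left[OF bounded_bilinear_scaleC]
lemmas bounded_linear_scaleC_right = bounded_bilinear.bounded_linear_right[OF bounded_bilinear_scaleC]

lemma scaleC_one [simp]: "1 *\<^sub>C (x::'a::complex_banach) = x"
  using scaleC_of_real[of 1 x] by simp

lemma scaleC_zero [simp]: "0 *\<^sub>C (x::'a::complex_banach) = 0" "c *\<^sub>C (0::'a) = 0"
  using bounded_bilinear.zero_left[OF bounded_bilinear_scaleC]
    bounded_bilinear.zero_right[OF bounded_bilinear_scaleC] by auto

text \<open>
  Complex differentiability of a vector-valued function: real (Frechet) differentiability with a
  complex linear derivative.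
\<close>

definition has_complex_derivative ::
    "(complex \<Rightarrow> 'a::complex_banach) \<Rightarrow> 'a \<Rightarrow> complex \<Rightarrow> complex set \<Rightarrow> bool" where
  "has_complex_derivative f D z S \<longleftrightarrow> (f has_derivative (\<lambda>h. h *\<^sub>C D)) (at z within S)"

lemma has_complex_derivative_scaleC_left:
  assumes "(c has_field_derivative c') (at z within S)"
  shows "has_complex_derivative (\<lambda>z. c z *\<^sub>C x) (c' *\<^sub>C x) z S"
  unfolding has_complex_derivative_def
  using bounded_linear.has_derivative[OF bounded_linear_scaleC_left assms[unfolded has_field_derivative_def]]
  by (simp add: scaleC_scaleC mult.commute)

lemma has_complex_derivative_diff:
  assumes "has_complex_derivative f D z S" "has_complex_derivative f' D' z S"
  shows "has_complex_derivative (\<lambda>z. f z - f' z) (D - D') z S"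
  using has_derivative_diff assms unfolding has_complex_derivative_def
  by (fastforce simp: scaleC_diff_right)

text \<open>
  Along horizontal lines (\<open>q\<close> real) and vertical lines (\<open>q = \<i>\<close> up to a real factor) the derivatives
  differ by the factor \<open>\<i>\<close> only: these are the Cauchy-Riemann equations in the form in which the
  shift of contours uses them.
\<close>

lemma has_complex_derivative_along_segment:
  fixes f :: "complex \<Rightarrow> 'a::complex_banach"
  assumes "has_complex_derivative f D (p + of_real x * q) S"
    and "\<And>x. x \<in> X \<Longrightarrow> p + of_real x * q \<in> S"
  shows "((\<lambda>x. f (p + of_real x * q)) has_vector_derivative q *\<^sub>C D) (at x within X)"
proof -
  have "((\<lambda>x. p + of_real x * q) has_derivative (\<lambda>h. of_real h * q)) (at x within X)"
    by (auto intro!: derivative_eq_intros)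
  then have "((\<lambda>x. f (p + of_real x * q)) has_derivative (\<lambda>h. (of_real h * q) *\<^sub>C D)) (at x within X)"
    by (rule has_derivative_in_compose)
       (use assms in \<open>auto simp: has_complex_derivative_def intro: has_derivative_subset\<close>)
  then show ?thesis
    by (simp add: has_vector_derivative_def scaleC_of_real flip: scaleC_scaleC)
qed

text \<open>
  Cauchy's theorem for a rectangle with one vertical side on \<open>Re z = a\<close>, in the form of an estimate
  by the other three sides. It is proved by moving the vertical segment from \<open>Re z = a\<close> to
  \<open>Re z = b\<close>: differentiating under the integral produces \<open>f'\<close>, which is also \<open>-\<i>\<close> times the
  derivative of \<open>f\<close> along the segment, so the rate of change is a multiple of the difference of two values of \<open>f\<close> on
  the horizontal sides. The segment may move in either direction.
\<close>

lemma vertical_integral_shift_bound: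
  fixes f :: "complex \<Rightarrow> 'a::complex_banach"
  assumes "N \<ge> 0" "c \<ge> 0"
    and der: "\<And>z. z \<in> S \<Longrightarrow> has_complex_derivative f (f' z) z S"
    and cont: "continuous_on S f'"
    and S: "S = {z. Re z \<in> closed_segment a b \<and> \<bar>Im z\<bar> \<le> N}"
    and horizontal: "\<And>z. z \<in> S \<Longrightarrow> \<bar>Im z\<bar> = N \<Longrightarrow> norm (f z) \<le> c"
    and vertical: "\<And>z. z \<in> S \<Longrightarrow> Re z = b \<Longrightarrow> norm (f z) \<le> c"
  shows "norm (integral {-N..N} (\<lambda>\<xi>. f (Complex a \<xi>))) \<le> 2 * c * (\<bar>b - a\<bar> + N)"
proof -
  \<comment> \<open>\<open>x \<in> [0, 1]\<close> parametrises the position of the moving segment.\<close>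
  define p where "p x \<xi> = Complex (a + x * (b - a)) \<xi>" for x \<xi>
  define F where "F x = integral (cbox (-N) N) (\<lambda>\<xi>. f (p x \<xi>))" for x
  have pS: "p x \<xi> \<in> S" if "x \<in> {0..1}" "\<xi> \<in> {-N..N}" for x \<xi>
    using that by (auto simp: p_def S closed_segment_def algebra_simps intro!: exI[of _ x])
  have contf: "continuous_on S f"
    using der unfolding has_complex_derivative_def
    by (meson continuous_on_eq_continuous_within has_derivative_continuous)
  have contp: "continuous_on UNIV (\<lambda>q. p (fst q) (snd q))"
    by (auto simp: p_def Complex_eq intro!: continuous_intros)
  have dx: "((\<lambda>x. f (p x \<xi>)) has_vector_derivative of_real (b - a) *\<^sub>C f' (p x \<xi>)) (at x within {0..1})"
    if "x \<in> {0..1}" "\<xi> \<in> {-N..N}" for x \<xi>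
  proof -
    have eq: "p x \<xi> = Complex a \<xi> + of_real x * of_real (b - a)" for x
      by (simp add: p_def complex_eq_iff)
    show ?thesis
      unfolding eq using that pS
      by (intro has_complex_derivative_along_segment[where S = S] der) (auto simp del: of_real_diff of_real_add of_real_mult simp flip: eq)
  qed
  have dxi: "((\<lambda>\<xi>. f (p x \<xi>)) has_vector_derivative \<i> *\<^sub>C f' (p x \<xi>)) (at \<xi> within {-N..N})"
    if "x \<in> {0..1}" "\<xi> \<in> {-N..N}" for x \<xi>
  proof -
    have eq: "p x \<xi> = of_real (a + x * (b - a)) + of_real \<xi> * \<i>" for \<xi>
      by (simp add: p_def complex_eq_iff)
    show ?thesis
      unfolding eq using that pS
      by (intro has_complex_derivative_along_segment[where S = S] der) (auto simp del: of_real_diff of_real_add of_real_mult simp flip: eq)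
  qed
  have fint: "(\<lambda>\<xi>. f (p x \<xi>)) integrable_on cbox (-N) N" if "x \<in> {0..1}" for x
    by (intro integrable_continuous continuous_on_compose2[OF contf] 
        continuous_on_compose2[OF contp, of _ "\<lambda>\<xi>. (x, \<xi>)", simplified] continuous_intros)
       (use that pS in auto)
  have F': "(F has_vector_derivative integral (cbox (-N) N) (\<lambda>\<xi>. of_real (b - a) *\<^sub>C f' (p x \<xi>))) (at x within {0..1})"
    if "x \<in> {0..1}" for x
    unfolding F_def
  proof (rule leibniz_rule_vector_derivative)
    show "continuous_on ({0..1} \<times> cbox (- N) N) (\<lambda>(x, \<xi>). complex_of_real (b - a) *\<^sub>C f' (p x \<xi>))"
      unfolding case_prod_unfold
      by (intro continuous_intros continuous_on_compose2[OF cont] continuous_on_subset[OF contp])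
         (use pS in auto)
  qed (use that dx fint in auto)
  \<comment> \<open>By the fundamental theorem of calculus in \<open>\<xi>\<close>, only the two end points of the segment remain.\<close>
  have bound: "norm (integral (cbox (-N) N) (\<lambda>\<xi>. of_real (b - a) *\<^sub>C f' (p x \<xi>))) \<le> 2 * c * \<bar>b - a\<bar>"
    if x: "x \<in> {0..1}" for x
  proof -
    have "((\<lambda>\<xi>. \<i> *\<^sub>C f' (p x \<xi>)) has_integral f (p x N) - f (p x (-N))) {-N..N}"
      using \<open>N \<ge> 0\<close> x dxi by (intro fundamental_theorem_of_calculus) auto
    then have "((\<lambda>\<xi>. (- \<i> * of_real (b - a)) *\<^sub>C \<i> *\<^sub>C f' (p x \<xi>)) has_integral
        (- \<i> * of_real (b - a)) *\<^sub>C (f (p x N) - f (p x (-N)))) {-N..N}"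
      by (rule has_integral_linear[OF _ bounded_linear_scaleC_right, unfolded o_def])
    then have "integral {-N..N} (\<lambda>\<xi>. of_real (b - a) *\<^sub>C f' (p x \<xi>)) =
        (- \<i> * of_real (b - a)) *\<^sub>C (f (p x N) - f (p x (-N)))"
      by (intro integral_unique) (simp add: scaleC_scaleC mult.commute mult.assoc)
    moreover have "norm (f (p x N) - f (p x (-N))) \<le> c + c"
      by (intro order_trans[OF norm_triangle_ineq4] add_mono horizontal pS)
         (use x \<open>N \<ge> 0\<close> in \<open>auto simp: p_def\<close>)
    then have "\<bar>b - a\<bar> * norm (f (p x N) - f (p x (-N))) \<le> \<bar>b - a\<bar> * (2 * c)"
      by (intro mult_left_mono) auto
    ultimately show ?thesis
      by (simp add: norm_scaleC norm_mult mult.commute del: of_real_diff)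
  qed
  have "norm (F 1 - F 0) \<le> 2 * c * \<bar>b - a\<bar> * norm (1 - 0 :: real)"
    by (rule differentiable_bound[OF convex_real_interval(5)])
       (use F' bound in \<open>auto simp: has_vector_derivative_def mult.commute intro!: onorm_bound mult_left_mono mult_nonneg_nonneg \<open>c \<ge> 0\<close>\<close>)
  moreover have "norm (F 1) \<le> c * (N - (- N))"
    unfolding F_def cbox_interval
    by (intro integral_bound continuous_on_compose2[OF contf]
        continuous_on_compose2[OF contp, of _ "\<lambda>\<xi>. (1, \<xi>)", simplified] continuous_intros vertical pS)
       (use pS[of 1] \<open>N \<ge> 0\<close> in \<open>auto simp: p_def\<close>)
  ultimately have "norm (F 0) \<le> 2 * c * (\<bar>b - a\<bar> + N)"
    using norm_triangle_ineq4[of "F 1" "F 1 - F 0"] \<open>N \<ge> 0\<close> by (simp add: algebra_simps)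
  then show ?thesis
    by (simp add: F_def p_def)
qed

section \<open>Orbits of a semigroup\<close>

locale semigroup_generator =
  fixes T :: "real \<Rightarrow> 'a::complex_banach \<Rightarrow> 'a" and A :: "'a \<rightharpoonup> 'a" and K w :: real
  assumes semigroup: "C0_semigroup T"
    and generator: "op_uminus A = generator T"
    and K: "K \<ge> 1"
    and growth: "t \<ge> 0 \<Longrightarrow> onorm (T t) \<le> K * exp (w * t)"
begin

lemma bounded_linear_T: "t \<ge> 0 \<Longrightarrow> bounded_linear (T t)"
  and T_scaleC: "t \<ge> 0 \<Longrightarrow> T t (c *\<^sub>C x) = c *\<^sub>C T t x"
  and T_0: "T 0 x = x"
  and T_add: "s \<ge> 0 \<Longrightarrow> t \<ge> 0 \<Longrightarrow> T (s + t) x = T s (T t x)"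
  and T_tendsto: "((\<lambda>t. T t x) \<longlongrightarrow> x) (at_right 0)"
  using semigroup by (auto simp: C0_semigroup_def bounded_clinear_def)

lemma norm_T_le: "t \<ge> 0 \<Longrightarrow> norm (T t x) \<le> K * exp (w * t) * norm x"
  using onorm[OF bounded_linear_T, of t x] mult_right_mono[OF growth, of t "norm x"] by simp

text \<open>
  A bound that is uniform on \<open>[0, \<tau>]\<close>; the absolute value covers growth rates of either sign.
\<close>

lemma norm_T_le_uniform:
  assumes "0 \<le> t" "t \<le> \<tau>"
  shows "norm (T t x) \<le> K * exp (\<bar>w\<bar> * \<tau>) * norm x"
proof -
  have "w * t \<le> \<bar>w\<bar> * t"
    using assms by (intro mult_right_mono) auto
  also have "\<dots> \<le> \<bar>w\<bar> * \<tau>"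
    using assms by (intro mult_left_mono) auto
  finally have "K * exp (w * t) * norm x \<le> K * exp (\<bar>w\<bar> * \<tau>) * norm x"
    using K by (intro mult_right_mono mult_left_mono) auto
  with norm_T_le[OF assms(1), of x] show ?thesis by simp
qed

lemma T_eventually_near:
  assumes "e > 0"
  obtains d where "d > 0" "\<And>h. 0 \<le> h \<Longrightarrow> h < d \<Longrightarrow> norm (T h x - x) < e"
proof -
  obtain d where "d > 0" "\<And>h. h > 0 \<Longrightarrow> h < d \<Longrightarrow> norm (T h x - x) < e"
    using T_tendsto[of x, THEN tendstoD, OF assms] unfolding eventually_at_right_field dist_norm
    by auto
  then have "norm (T h x - x) < e" if "0 \<le> h" "h < d" for h
    using that assms by (cases "h = 0") (auto simp: T_0)
  with \<open>d > 0\<close> show ?thesis by (rule that)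
qed

lemma continuous_on_orbit: "continuous_on {0..} (\<lambda>t. T t x)"
  unfolding continuous_on_iff
proof (intro ballI allI impI)
  fix t e :: real assume "t \<in> {0..}" "0 < e"
  then have t: "t \<ge> 0" by simp
  define C where "C = K * exp (\<bar>w\<bar> * (t + 1))"
  have C: "C > 0" using K by (simp add: C_def)
  have diff: "norm (T (r + h) x - T r x) \<le> C * norm (T h x - x)" if "0 \<le> r" "r \<le> t + 1" "0 \<le> h" for r h
  proof -
    have "T (r + h) x - T r x = T r (T h x - x)"
      using that by (simp add: T_add linear_diff[OF bounded_linear.linear[OF bounded_linear_T]])
    then show ?thesis using norm_T_le_uniform[OF that(1,2)] by (simp add: C_def)
  qed
  obtain d where "d > 0" and d: "\<And>h. 0 \<le> h \<Longrightarrow> h < d \<Longrightarrow> norm (T h x - x) < e / C"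
    using T_eventually_near[of "e / C" x] C \<open>0 < e\<close> by auto
  have "norm (T s x - T t x) < e" if s: "s \<ge> 0" "\<bar>s - t\<bar> < d" for s
  proof -
    have "norm (T s x - T t x) \<le> C * norm (T \<bar>s - t\<bar> x - x)"
    proof (cases "t \<le> s")
      case True then show ?thesis using diff[of t "s - t"] t by simp
    next
      case False then show ?thesis using diff[of s "t - s"] t s by (simp add: norm_minus_commute)
    qed
    also have "\<dots> < C * (e / C)"
      using d[of "\<bar>s - t\<bar>"] s C by (intro mult_strict_left_mono) auto
    finally show ?thesis using C by simp
  qed
  then show "\<exists>d>0. \<forall>s\<in>{0..}. dist s t < d \<longrightarrow> dist (T s x) (T t x) < e"
    using \<open>d > 0\<close> by (auto simp: dist_norm)
qed

lemma in_dom_iff: "u \<in> dom A \<and> the (A u) = - y \<longleftrightarrow> ((\<lambda>h. (T h u - u) /\<^sub>R h) \<longlongrightarrow> y) (at_right 0)"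
proof -
  have uniq: "(THE y. ((\<lambda>h. (T h u - u) /\<^sub>R h) \<longlongrightarrow> y) (at_right 0)) = y"
    if "((\<lambda>h. (T h u - u) /\<^sub>R h) \<longlongrightarrow> y) (at_right 0)" for y
    using that tendsto_unique[OF trivial_limit_at_right_real] by blast
  have "u \<in> dom A \<and> the (A u) = - y \<longleftrightarrow> generator T u = Some y"
    by (cases "A u") (auto simp: generator[symmetric] op_uminus_def minus_equation_iff)
  also have "\<dots> \<longleftrightarrow> ((\<lambda>h. (T h u - u) /\<^sub>R h) \<longlongrightarrow> y) (at_right 0)"
    unfolding generator_def using uniq by (auto split: if_splits)
  finally show ?thesis .
qed

lemma in_dom_diff:
  assumes "u \<in> dom A" "v \<in> dom A"
  shows "u - v \<in> dom A" "the (A (u - v)) = the (A u) - the (A v)"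
proof -
  have "((\<lambda>h. (T h u - u) /\<^sub>R h - (T h v - v) /\<^sub>R h) \<longlongrightarrow> - the (A u) - (- the (A v))) (at_right 0)"
    using in_dom_iff[of u "- the (A u)"] in_dom_iff[of v "- the (A v)"] assms
    by (intro tendsto_diff) auto
  moreover have "\<forall>\<^sub>F h in at_right 0. (T h u - u) /\<^sub>R h - (T h v - v) /\<^sub>R h = (T h (u - v) - (u - v)) /\<^sub>R h"
    using eventually_at_right_less[of 0] 
    by eventually_elim (simp add: linear_diff[OF bounded_linear.linear[OF bounded_linear_T]] algebra_simps)
  ultimately have "((\<lambda>h. (T h (u - v) - (u - v)) /\<^sub>R h) \<longlongrightarrow> - the (A u) - (- the (A v))) (at_right 0)"
    by (rule Lim_transform_eventually)
  then show "u - v \<in> dom A" "the (A (u - v)) = the (A u) - the (A v)"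
    using in_dom_iff[of "u - v" "- the (A u) - (- the (A v))"] by auto
qed

text \<open>
  The generator only gives a right derivative at \<open>0\<close>. The semigroup law carries it to a right
  derivative at every \<open>t\<close>; for the left derivative the increment is \<open>T s (T h u - u)\<close> with
  \<open>s = t - h\<close>, and the strong continuity of the orbit of \<open>A u\<close> is needed to replace \<open>T s\<close> by \<open>T t\<close>.
\<close>

lemma orbit_has_vector_derivative:
  assumes u: "u \<in> dom A" and t: "t \<ge> 0"
  shows "((\<lambda>s. T s u) has_vector_derivative - T t (the (A u))) (at t within {0..})"
  unfolding has_vector_derivative_def has_derivative_within_alt
proof (intro conjI allI impI)
  show "bounded_linear (\<lambda>h. h *\<^sub>R (- T t (the (A u))))"
    by (rule bounded_linear_scaleR_left)
  fix e :: real assume "e > 0"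
  define D where "D = - the (A u)"
  define C where "C = K * exp (\<bar>w\<bar> * (t + 1))"
  have C: "C > 0" using K by (simp add: C_def)
  have TD: "- T t (the (A u)) = T t D"
    using t by (simp add: D_def linear_neg[OF bounded_linear.linear[OF bounded_linear_T]])
  have "((\<lambda>h. (T h u - u) /\<^sub>R h) \<longlongrightarrow> D) (at_right 0)"
    using in_dom_iff[of u D] u by (simp add: D_def)
  from tendstoD[OF this, of "e / (2 * C)"] \<open>e > 0\<close> C
  obtain d1 where d1: "d1 > 0" and d1': "\<And>h. h > 0 \<Longrightarrow> h < d1 \<Longrightarrow> norm ((T h u - u) /\<^sub>R h - D) < e / (2 * C)"
    by (auto simp: eventually_at_right_field dist_norm)
  obtain d2 where d2: "d2 > 0" and d2': "\<And>s. s \<ge> 0 \<Longrightarrow> \<bar>s - t\<bar> < d2 \<Longrightarrow> norm (T s D - T t D) < e / 2"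
    using continuous_on_orbit[of D, unfolded continuous_on_iff, rule_format, of t "e / 2"] t \<open>e > 0\<close>
    by (auto simp: dist_norm)
  have incr: "norm (T (r + h) u - T r u - h *\<^sub>R T r D) \<le> h * (e / 2)"
    if "0 \<le> r" "r \<le> t + 1" "0 < h" "h < d1" for r h
  proof -
    have "T (r + h) u - T r u - h *\<^sub>R T r D = h *\<^sub>R T r ((T h u - u) /\<^sub>R h - D)"
    proof -
      have "linear (T r)" using bounded_linear.linear[OF bounded_linear_T] that by blast
      then show ?thesis
        using that by (simp add: T_add linear_diff linear_scale scaleR_diff_right)
    qed
    moreover have "norm (T r ((T h u - u) /\<^sub>R h - D)) \<le> C * (e / (2 * C))"
      using norm_T_le_uniform[OF that(1,2)] d1'[OF that(3,4)] C
      by (smt (verit, best) C_def mult_left_mono)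
    ultimately show ?thesis using that C by (auto intro!: mult_left_mono)
  qed
  have "norm (T s u - T t u - (s - t) *\<^sub>R T t D) \<le> e * \<bar>s - t\<bar>"
    if s: "s \<ge> 0" "\<bar>s - t\<bar> < min d1 d2" for s
  proof -
    consider "s = t" | "s > t" | "s < t" by linarith
    then show ?thesis
    proof cases
      case 1 then show ?thesis by simp
    next
      case 2
      then have "norm (T s u - T t u - (s - t) *\<^sub>R T t D) \<le> (s - t) * (e / 2)"
        using incr[of t "s - t"] t s by simp
      also have "\<dots> \<le> (s - t) * e"
        using 2 \<open>e > 0\<close> by (intro mult_left_mono) auto
      finally show ?thesis using 2 by (simp add: mult.commute)
    next
      case 3
      have "T s u - T t u - (s - t) *\<^sub>R T t D =
          - (T t u - T s u - (t - s) *\<^sub>R T s D) - (t - s) *\<^sub>R (T s D - T t D)"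
        by (simp add: algebra_simps)
      also have "norm \<dots> \<le> norm (T t u - T s u - (t - s) *\<^sub>R T s D) + norm ((t - s) *\<^sub>R (T s D - T t D))"
        by (metis norm_triangle_ineq4 norm_minus_cancel)
      also have "\<dots> \<le> (t - s) * (e / 2) + (t - s) * (e / 2)"
        using incr[of s "t - s"] 3 t s d2'[of s] by (intro add_mono) (auto intro!: mult_left_mono)
      finally show ?thesis using 3 by (simp add: field_simps)
    qed
  qed
  then show "\<exists>d>0. \<forall>s\<in>{0..}. norm (s - t) < d \<longrightarrow>
      norm (T s u - T t u - (s - t) *\<^sub>R - T t (the (A u))) \<le> e * norm (s - t)"
    unfolding TD using d1 d2 by (intro exI[of _ "min d1 d2"]) auto
qed

text \<open>
  The source of all links between \<open>T\<close> and the resolvent: \<open>exp (z r) T (t - r) u\<close> interpolates between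
  \<open>T t u\<close> and \<open>exp (z t) u\<close>, and its derivative is \<open>exp (z r) T (t - r) (z + A) u\<close>. The identity holds
  for every complex \<open>z\<close>, also to the left of the growth bound, where the Laplace transform of \<open>T\<close>
  may diverge.
\<close>

lemma exp_orbit_integral:
  assumes u: "u \<in> dom A" and t: "t \<ge> 0"
  shows "((\<lambda>r. exp (z * of_real r) *\<^sub>C T (t - r) (z *\<^sub>C u + the (A u))) has_integral
    exp (z * of_real t) *\<^sub>C u - T t u) {0..t}"
proof -
  have "((\<lambda>r. exp (z * of_real r) *\<^sub>C T (t - r) (z *\<^sub>C u + the (A u))) has_integral
      exp (z * of_real t) *\<^sub>C T (t - t) u - exp (z * of_real 0) *\<^sub>C T (t - 0) u) {0..t}"
  proof (rule fundamental_theorem_of_calculus[OF t])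
    fix r assume r: "r \<in> {0..t}"
    have 1: "((\<lambda>r. exp (z * of_real r)) has_vector_derivative z * exp (z * of_real r)) (at r within {0..t})"
      by (rule has_vector_derivative_real_field) (auto intro!: derivative_eq_intros)
    have 2: "((\<lambda>r. T (t - r) u) has_vector_derivative T (t - r) (the (A u))) (at r within {0..t})"
    proof -
      have "((\<lambda>r. t - r) has_vector_derivative -1) (at r within {0..t})"
        by (auto intro!: derivative_eq_intros)
      moreover have "((\<lambda>s. T s u) has_vector_derivative - T (t - r) (the (A u)))
          (at (t - r) within (\<lambda>r. t - r) ` {0..t})"
        using orbit_has_vector_derivative[OF u, of "t - r"] r
        by (rule_tac has_vector_derivative_within_subset) auto
      ultimately show ?thesis
        using vector_diff_chain_within by (force simp: o_def)
    qed
    show "((\<lambda>r. exp (z * of_real r) *\<^sub>C T (t - r) u) has_vector_derivative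
        exp (z * of_real r) *\<^sub>C T (t - r) (z *\<^sub>C u + the (A u))) (at r within {0..t})"
      using bounded_bilinear.has_vector_derivative[OF bounded_bilinear_scaleC 1 2] r
      by (simp add: linear_add[OF bounded_linear.linear[OF bounded_linear_T]] T_scaleC
          scaleC_add_right scaleC_scaleC mult.commute add.commute)
  qed
  then show ?thesis by (simp add: T_0)
qed

text \<open>
  This is the Hille-Yosida bound in the form of an a priori estimate. Dividing the previous identity
  by \<open>exp (c t)\<close> and letting \<open>t\<close> tend to infinity removes the term \<open>T t u\<close>.
\<close>

lemma norm_le_norm_shift:
  fixes c :: real
  assumes u: "u \<in> dom A" and c: "c > w"
  shows "norm u \<le> K / (c - w) * norm (of_real c *\<^sub>C u + the (A u))"
proof -
  define x where "x = of_real c *\<^sub>C u + the (A u)"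
  have bound: "norm u \<le> K * exp ((w - c) * t) * norm u + K / (c - w) * norm x" if t: "t \<ge> 0" for t
  proof -
    have int: "((\<lambda>r. exp (of_real c * of_real r) *\<^sub>C T (t - r) x) has_integral
        exp (of_real c * of_real t) *\<^sub>C u - T t u) {0..t}"
      using exp_orbit_integral[OF u t, of "of_real c"] by (simp add: x_def)
    have "((\<lambda>r. exp ((c - w) * r)) has_integral exp ((c - w) * t) / (c - w) - exp ((c - w) * 0) / (c - w)) {0..t}"
      using c t by (intro fundamental_theorem_of_calculus)
        (auto intro!: derivative_eq_intros simp: has_vector_derivative_def mult.commute)
    from has_integral_mult_right[OF this, of "K * exp (w * t) * norm x"]
    have int': "((\<lambda>r. K * exp (w * t) * norm x * exp ((c - w) * r)) has_integral
        K * exp (w * t) * norm x * ((exp ((c - w) * t) - 1) / (c - w))) {0..t}"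
      by (simp add: diff_divide_distrib)
    have le: "norm (exp (of_real c * of_real r) *\<^sub>C T (t - r) x) \<le> K * exp (w * t) * norm x * exp ((c - w) * r)"
      if "r \<in> {0..t}" for r
    proof -
      have "norm (exp (of_real c * of_real r) *\<^sub>C T (t - r) x) = exp (c * r) * norm (T (t - r) x)"
        by (simp add: norm_scaleC)
      also have "\<dots> \<le> exp (c * r) * (K * exp (w * (t - r)) * norm x)"
        using that by (intro mult_left_mono norm_T_le) auto
      also have "\<dots> = K * exp (w * t) * norm x * exp ((c - w) * r)"
        by (simp add: mult_ac flip: exp_add) (simp add: algebra_simps flip: exp_add)
      finally show ?thesis .
    qed
    have "norm (exp (of_real c * of_real t) *\<^sub>C u - T t u) \<le>
        K * exp (w * t) * norm x * ((exp ((c - w) * t) - 1) / (c - w))"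
      using integral_norm_bound_integral[OF has_integral_integrable[OF int] has_integral_integrable[OF int'] le]
      by (simp only: integral_unique[OF int] integral_unique[OF int'])
    also have "\<dots> \<le> K * exp (w * t) * norm x * (exp ((c - w) * t) / (c - w))"
      using K c by (intro mult_left_mono divide_right_mono) auto
    finally have "norm (exp (of_real c * of_real t) *\<^sub>C u) \<le> K * exp (w * t) * norm u + K * exp (w * t) * norm x * (exp ((c - w) * t) / (c - w))"
      using norm_T_le[OF t, of u] norm_triangle_ineq2[of "exp (of_real c * of_real t) *\<^sub>C u" "T t u"] by linarith
    then have "exp (c * t) * norm u \<le> K * exp (w * t) * norm u + K * norm x * exp (c * t) / (c - w)"
      by (simp add: norm_scaleC left_diff_distrib exp_diff)
    then have "exp (- c * t) * (exp (c * t) * norm u) \<le>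
        exp (- c * t) * (K * exp (w * t) * norm u + K * norm x * exp (c * t) / (c - w))"
      by (intro mult_left_mono) auto
    then show ?thesis
      by (simp add: left_diff_distrib exp_diff exp_minus field_simps)
  qed
  have "((\<lambda>t. exp ((w - c) * t)) \<longlongrightarrow> 0) at_top"
    using c by (intro filterlim_compose[OF exp_at_bot])
      (simp add: filterlim_ident filterlim_tendsto_neg_mult_at_bot[OF tendsto_const])
  then have "((\<lambda>t. K * exp ((w - c) * t) * norm u + K / (c - w) * norm x) \<longlongrightarrow>
      K * 0 * norm u + K / (c - w) * norm x) at_top"
    by (intro tendsto_intros)
  then have "norm u \<le> K * 0 * norm u + K / (c - w) * norm x"
    by (rule tendsto_lowerbound) (use eventually_mono[OF eventually_ge_at_top[of 0] bound] in auto)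
  then show ?thesis by (simp add: x_def)
qed

end

section \<open>Resolvents\<close>

text \<open>
  Surjectivity of \<open>z + A\<close> alone already makes \<open>op_inverse (op_shift z A)\<close> a right inverse, with values
  in the domain of \<open>A\<close>.
\<close>

definition shift_onto :: "complex \<Rightarrow> ('a::complex_banach \<rightharpoonup> 'a) \<Rightarrow> bool" where
  "shift_onto z A \<longleftrightarrow> (\<forall>x. \<exists>u\<in>dom A. z *\<^sub>C u + the (A u) = x)"

lemma dom_op_shift [simp]: "dom (op_shift z A) = dom A"
  by (auto simp: op_shift_def)

lemma the_op_shift: "u \<in> dom A \<Longrightarrow> the (op_shift z A u) = z *\<^sub>C u + the (A u)"
  by (auto simp: op_shift_def)

lemma op_shift_op_shift: "op_shift c (op_shift d A) = op_shift (c + d) A"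
  by (auto simp: op_shift_def option.map_comp o_def scaleC_add_left add.assoc)

lemma shift_onto_if_invertible: "op_invertible (op_shift z A) \<Longrightarrow> shift_onto z A"
  unfolding op_invertible_def bij_betw_def shift_onto_def
proof
  fix x
  assume "(inj_on (\<lambda>u. the (op_shift z A u)) (dom (op_shift z A)) \<and>
      (\<lambda>u. the (op_shift z A u)) ` dom (op_shift z A) = UNIV) \<and> bounded_clinear (op_inverse (op_shift z A))"
  then have "x \<in> (\<lambda>u. the (op_shift z A u)) ` dom (op_shift z A)" by simp
  then obtain u where u: "x = the (op_shift z A u)" "u \<in> dom (op_shift z A)" by (rule imageE)
  then show "\<exists>u\<in>dom A. z *\<^sub>C u + the (A u) = x"
    by (intro bexI[of _ u]) (simp_all only: dom_op_shift the_op_shift)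
qed

lemma op_inverse_solves:
  assumes "shift_onto z A"
  shows "op_inverse (op_shift z A) x \<in> dom A"
    and "z *\<^sub>C op_inverse (op_shift z A) x + the (A (op_inverse (op_shift z A) x)) = x"
proof -
  have x: "x \<in> (\<lambda>u. the (op_shift z A u)) ` dom (op_shift z A)"
  proof -
    obtain u where "u \<in> dom A" "z *\<^sub>C u + the (A u) = x"
      using assms unfolding shift_onto_def by blast
    then show ?thesis
      by (intro image_eqI[of _ _ u]) (simp_all add: the_op_shift)
  qed
  show "op_inverse (op_shift z A) x \<in> dom A"
    using inv_into_into[OF x] by (simp add: op_inverse_def)
  then show "z *\<^sub>C op_inverse (op_shift z A) x + the (A (op_inverse (op_shift z A) x)) = x"
    using f_inv_into_f[OF x] the_op_shift[of _ A z] by (metis op_inverse_def)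
qed

lemma op_inverse_unique:
  assumes "op_invertible (op_shift z A)" "u \<in> dom A"
  shows "op_inverse (op_shift z A) (z *\<^sub>C u + the (A u)) = u"
proof -
  have "inj_on (\<lambda>u. the (op_shift z A u)) (dom (op_shift z A))"
    using assms(1) by (simp only: op_invertible_def bij_betw_def)
  from inv_into_f_f[OF this, of u] assms(2) show ?thesis
    by (simp add: op_inverse_def the_op_shift)
qed

context semigroup_generator
begin

lemma norm_op_inverse_le:
  assumes "shift_onto (of_real c) A" "c > w"
  shows "norm (op_inverse (op_shift (of_real c) A) x) \<le> K / (c - w) * norm x"
  using norm_le_norm_shift[OF op_inverse_solves(1)[OF assms(1)] assms(2), of x]
  by (simp add: op_inverse_solves(2)[OF assms(1)])

text \<open>
  The equation \<open>(c' + A) u = x\<close> says that \<open>u\<close> is a fixed point of \<open>v \<mapsto> (c + A)\<^sup>-\<^sup>1 (x + (c - c') v)\<close>,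
  which is a contraction by the a priori estimate.
\<close>

lemma shift_onto_perturb:
  fixes c c' :: real
  assumes onto: "shift_onto (of_real c) A" and "c > w" and near: "K / (c - w) * \<bar>c - c'\<bar> < 1"
  shows "shift_onto (of_real c') A"
  unfolding shift_onto_def
proof
  fix x
  define R where "R = op_inverse (op_shift (of_real c) A)"
  note R = op_inverse_solves[OF onto, folded R_def]
  define F where "F v = R (x + (c - c') *\<^sub>R v)" for v
  have Lip: "norm (R y - R y') \<le> K / (c - w) * norm (y - y')" for y y'
  proof -
    have "of_real c *\<^sub>C (R y - R y') + the (A (R y - R y')) =
        (of_real c *\<^sub>C R y + the (A (R y))) - (of_real c *\<^sub>C R y' + the (A (R y')))"
      by (simp add: in_dom_diff(2)[OF R(1) R(1)] scaleC_diff_right)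
    also have "\<dots> = y - y'"
      by (simp only: R(2))
    finally show ?thesis
      using norm_le_norm_shift[OF in_dom_diff(1)[OF R(1) R(1)] \<open>c > w\<close>, of y y'] by simp
  qed
  have "dist (F v) (F v') \<le> K / (c - w) * \<bar>c - c'\<bar> * dist v v'" for v v'
    using Lip[of "x + (c - c') *\<^sub>R v" "x + (c - c') *\<^sub>R v'"]
    by (simp add: F_def dist_norm mult.assoc flip: scaleR_diff_right)
  then obtain u where "F u = u"
    using banach_fix_type[of "K / (c - w) * \<bar>c - c'\<bar>" F] near K \<open>c > w\<close> by auto
  then have "u \<in> dom A" "of_real c *\<^sub>C u + the (A u) = x + (c - c') *\<^sub>R u"
    using R[of "x + (c - c') *\<^sub>R u"] by (auto simp: F_def)
  then show "\<exists>u\<in>dom A. of_real c' *\<^sub>C u + the (A u) = x"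
    by (intro bexI[of _ u]) (auto simp: scaleC_of_real algebra_simps)
qed

text \<open>
  The half-plane in which the resolvent is given ends at \<open>0\<close>, but for an exponentially stable
  semigroup the shift \<open>\<omega>\<close> may be negative, and then the fractional powers involve resolvents at points
  \<open>c\<close> with \<open>w < c \<le> 0\<close>. They are reached from the right in steps whose length \<open>\<delta>\<close> is uniform,
  because the a priori estimate has the same constant at all points right of \<open>c\<close>.
\<close>

lemma shift_onto_right_of_growth:
  fixes c :: real
  assumes pos: "\<And>c. c > 0 \<Longrightarrow> shift_onto (of_real c) A" and c: "c > w"
  shows "shift_onto (of_real c) A"
proof -
  define \<delta> where "\<delta> = (c - w) / (2 * K)"
  have \<delta>: "\<delta> > 0" using c K by (simp add: \<delta>_def)
  have "shift_onto (of_real c') A" if "c' \<ge> c" "c' > - (real n * \<delta>)" for n c'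
    using that
  proof (induction n arbitrary: c')
    case 0 then show ?case using pos by simp
  next
    case (Suc n)
    have "shift_onto (of_real (c' + \<delta>)) A"
      using Suc.prems \<delta> by (intro Suc.IH) (auto simp: algebra_simps)
    moreover have "K / (c' + \<delta> - w) * \<bar>c' + \<delta> - c'\<bar> < 1"
    proof -
      have "K * \<delta> = (c - w) / 2" using K by (simp add: \<delta>_def)
      also have "\<dots> < c' + \<delta> - w" using Suc.prems(1) c \<delta> by (simp add: field_simps)
      finally show ?thesis using \<delta> Suc.prems(1) c by (simp add: field_simps)
    qed
    ultimately show ?case
      using shift_onto_perturb[of "c' + \<delta>" c'] Suc.prems(1) c \<delta> by simp
  qed
  moreover obtain n where "- c / \<delta> < real n"
    using reals_Archimedean2 by blast
  then have "c > - (real n * \<delta>)" using \<delta> by (simp add: field_simps)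
  ultimately show ?thesis by blast
qed

end

section \<open>The resolvent in a half-plane\<close>

text \<open>
  The resolvent is assumed to be bounded by one constant \<open>G\<close> on a closed half-plane, whose boundary
  may lie to the left of the growth bound. In the application the boundary is \<open>Re z = 1 / t\<close> and \<open>G\<close>
  is the value \<open>g t\<close>.
\<close>

locale semigroup_resolvent_half_plane = semigroup_generator +
  fixes a G :: real
  assumes invertible: "Re z \<ge> a \<Longrightarrow> op_invertible (op_shift z A)"
    and resolvent_bound: "Re z \<ge> a \<Longrightarrow> onorm (op_inverse (op_shift z A)) \<le> G"
begin

definition R :: "complex \<Rightarrow> 'a \<Rightarrow> 'a" where
  "R z = op_inverse (op_shift z A)"

lemma bounded_linear_R: "Re z \<ge> a \<Longrightarrow> bounded_linear (R z)"
  and R_scaleC: "Re z \<ge> a \<Longrightarrow> R z (c *\<^sub>C x) = c *\<^sub>C R z x"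
  using invertible unfolding op_invertible_def bounded_clinear_def R_def by auto

lemma norm_R_le: "Re z \<ge> a \<Longrightarrow> norm (R z x) \<le> G * norm x"
  using onorm[OF bounded_linear_R, of z x] mult_right_mono[OF resolvent_bound, of z "norm x"]
  unfolding R_def by simp

lemma G_nonneg: "G \<ge> 0"
  using onorm_pos_le[OF bounded_linear_R, of "of_real a"] resolvent_bound[of "of_real a"]
  unfolding R_def by simp

lemma resolvent_identity:
  assumes "Re y \<ge> a" "Re z \<ge> a"
  shows "R z x = R y x - (z - y) *\<^sub>C R z (R y x)"
proof -
  note sol = op_inverse_solves[OF shift_onto_if_invertible[OF invertible[OF assms(1)]], of x, folded R_def]
  have "z *\<^sub>C R y x + the (A (R y x)) = x + (z - y) *\<^sub>C R y x"
    using sol(2) by (simp add: scaleC_diff_left algebra_simps)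
  then have "R z (x + (z - y) *\<^sub>C R y x) = R y x"
    using op_inverse_unique[OF invertible[OF assms(2)] sol(1)] by (simp add: R_def)
  then show ?thesis
    by (simp add: linear_add[OF bounded_linear.linear[OF bounded_linear_R[OF assms(2)]]]
        R_scaleC[OF assms(2)] eq_diff_eq)
qed

lemma norm_R_diff_le:
  assumes "Re y \<ge> a" "Re z \<ge> a"
  shows "norm (R z x - R y x) \<le> norm (z - y) * (G * (G * norm x))"
proof -
  have "norm (R z x - R y x) = norm (z - y) * norm (R z (R y x))"
    by (subst resolvent_identity[OF assms]) (simp add: norm_scaleC norm_minus_commute)
  also have "\<dots> \<le> norm (z - y) * (G * (G * norm x))"
    using G_nonneg assms by (intro mult_left_mono order_trans[OF norm_R_le]) (auto intro!: mult_left_mono norm_R_le)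
  finally show ?thesis .
qed

lemma R_has_complex_derivative:
  assumes "Re z \<ge> a" "S \<subseteq> {z. Re z \<ge> a}"
  shows "has_complex_derivative (\<lambda>z. R z x) (- R z (R z x)) z S"
  unfolding has_complex_derivative_def has_derivative_within_alt
proof (intro conjI allI impI)
  show "bounded_linear (\<lambda>h. h *\<^sub>C (- R z (R z x)))"
    by (rule bounded_linear_scaleC_left)
  fix e :: real assume "e > 0"
  define C where "C = G * (G * (G * norm x)) + 1"
  have C: "C > 0" using G_nonneg by (simp add: C_def add_nonneg_pos)
  have "norm (R y x - R z x - (y - z) *\<^sub>C (- R z (R z x))) \<le> e * norm (y - z)"
    if y: "y \<in> S" "norm (y - z) < e / C" for y
  proof -
    have ya: "Re y \<ge> a" using y assms(2) by auto
    have "R y x - R z x - (y - z) *\<^sub>C (- R z (R z x)) = - ((y - z) *\<^sub>C (R y (R z x) - R z (R z x)))"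
      by (subst resolvent_identity[OF assms(1) ya])
         (simp add: scaleC_diff_right scaleC_minus_right)
    then have "norm (R y x - R z x - (y - z) *\<^sub>C (- R z (R z x))) =
        norm (y - z) * norm (R y (R z x) - R z (R z x))"
      by (simp add: norm_scaleC)
    also have "\<dots> \<le> norm (y - z) * (norm (y - z) * (G * (G * (G * norm x))))"
      using G_nonneg assms(1) ya
      by (intro mult_left_mono order_trans[OF norm_R_diff_le]) (auto intro!: mult_left_mono norm_R_le)
    also have "\<dots> \<le> norm (y - z) * (norm (y - z) * C)"
      by (intro mult_left_mono) (auto simp: C_def)
    also have "\<dots> \<le> norm (y - z) * (e / C * C)"
      using y(2) C by (intro mult_left_mono mult_right_mono) auto
    finally show ?thesis using C by (simp add: mult.commute)
  qed
  then show "\<exists>d>0. \<forall>y\<in>S. norm (y - z) < d \<longrightarrow>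
      norm (R y x - R z x - (y - z) *\<^sub>C (- R z (R z x))) \<le> e * norm (y - z)"
    using \<open>e > 0\<close> C by (intro exI[of _ "e / C"]) auto
qed

lemma continuous_on_R: "continuous_on {z. Re z \<ge> a} (\<lambda>z. R z x)"
  unfolding continuous_on_eq_continuous_within
  using R_has_complex_derivative[of _ "{z. Re z \<ge> a}" x, unfolded has_complex_derivative_def,
      THEN has_derivative_continuous] by simp

lemma continuous_on_R_R: "continuous_on {z. Re z \<ge> a} (\<lambda>z. R z (R z x))"
  unfolding continuous_on_def
proof
  fix z assume "z \<in> {z. Re z \<ge> a}"
  then have z: "Re z \<ge> a" by simp
  define F where "F = at z within {z. Re z \<ge> a}"
  have 0: "((\<lambda>y. R y x - R z x) \<longlongrightarrow> 0) F" and 1: "((\<lambda>y. R y (R z x)) \<longlongrightarrow> R z (R z x)) F"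
    using continuous_on_R z unfolding continuous_on_def F_def LIM_zero_iff by auto
  have "\<forall>\<^sub>F y in F. norm (R y (R y x - R z x)) \<le> norm (R y x - R z x) * G"
    unfolding F_def eventually_at_filter by (auto simp: norm_R_le mult.commute)
  then have "((\<lambda>y. R y (R y x - R z x)) \<longlongrightarrow> 0) F"
    by (rule tendsto_0_le[OF 0])
  from tendsto_add[OF this 1] have "((\<lambda>y. R y (R y x - R z x) + R y (R z x)) \<longlongrightarrow> 0 + R z (R z x)) F" .
  moreover have "\<forall>\<^sub>F y in F. R y (R y x - R z x) + R y (R z x) = R y (R y x)"
    unfolding F_def eventually_at_filter
    by (auto simp: linear_diff[OF bounded_linear.linear[OF bounded_linear_R]])
  ultimately show "((\<lambda>y. R y (R y x)) \<longlongrightarrow> R z (R z x)) (at z within {z. Re z \<ge> a})"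
    unfolding F_def[symmetric] using Lim_transform_eventually by force
qed

end

section \<open>Smoothed orbits\<close>

text \<open>
  The double pole at \<open>\<sigma>\<close> lies to the right of the line \<open>Re z = a\<close>, and \<open>exp (z r)\<close> is bounded to the
  left of it, so closing the contour on the left shows that the integral tends to \<open>0\<close>. The bound is
  uniform for \<open>r\<close> in bounded sets.
\<close>

lemma exp_pole_integral_bound:
  fixes y :: "'a::complex_banach"
  assumes "r \<ge> 0" "\<sigma> > a" "N > 0"
  shows "norm (integral {-N..N} (\<lambda>\<xi>. (exp (Complex a \<xi> * of_real r) / (Complex a \<xi> - of_real \<sigma>)\<^sup>2) *\<^sub>C y))
    \<le> 4 * exp (a * r) * norm y / N"
proof -
  define S where "S = {z. Re z \<in> closed_segment a (a - N) \<and> \<bar>Im z\<bar> \<le> N}"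
  have S: "Re z \<le> a \<and> z \<noteq> of_real \<sigma>" if "z \<in> S" for z
    using that assms by (auto simp: S_def closed_segment_eq_real_ivl)
  have bound: "norm ((exp (z * of_real r) / (z - of_real \<sigma>)\<^sup>2) *\<^sub>C y) \<le> exp (a * r) * norm y / N\<^sup>2"
    if z: "z \<in> S" "norm (z - of_real \<sigma>) \<ge> N" for z
  proof -
    have "norm (exp (z * of_real r)) \<le> exp (a * r)"
      using S[OF z(1)] \<open>r \<ge> 0\<close> by (auto simp: norm_exp_eq_Re intro: mult_right_mono)
    moreover have "N\<^sup>2 \<le> (norm (z - of_real \<sigma>))\<^sup>2"
      using z(2) \<open>N > 0\<close> by (intro power_mono) auto
    ultimately have "norm (exp (z * of_real r)) / (norm (z - of_real \<sigma>))\<^sup>2 \<le> exp (a * r) / N\<^sup>2"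
      using \<open>N > 0\<close> by (intro frac_le) auto
    then have "norm (exp (z * of_real r)) / (norm (z - of_real \<sigma>))\<^sup>2 * norm y \<le> exp (a * r) / N\<^sup>2 * norm y"
      by (intro mult_right_mono) auto
    then show ?thesis by (simp add: norm_scaleC norm_divide norm_power)
  qed
  define D where "D z = (exp (z * of_real r) * of_real r * (z - of_real \<sigma>)\<^sup>2 -
      exp (z * of_real r) * (2 * (z - of_real \<sigma>))) / ((z - of_real \<sigma>)\<^sup>2 * (z - of_real \<sigma>)\<^sup>2)" for z :: complex
  have "norm (integral {-N..N} (\<lambda>\<xi>. (exp (Complex a \<xi> * of_real r) / (Complex a \<xi> - of_real \<sigma>)\<^sup>2) *\<^sub>C y))
      \<le> 2 * (exp (a * r) * norm y / N\<^sup>2) * (\<bar>(a - N) - a\<bar> + N)"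
  proof (rule vertical_integral_shift_bound[OF _ _ _ _ S_def,
        where f' = "\<lambda>z. (D z) *\<^sub>C y"])
    fix z assume z: "z \<in> S"
    have nz: "z - of_real \<sigma> \<noteq> 0" using S[OF z] by simp
    have "((\<lambda>z. exp (z * of_real r) / (z - of_real \<sigma>)\<^sup>2) has_field_derivative
        D z) (at z within S)"
      unfolding D_def by (rule DERIV_divide) (use nz in \<open>auto intro!: derivative_eq_intros\<close>)
    then show "has_complex_derivative (\<lambda>z. (exp (z * of_real r) / (z - of_real \<sigma>)\<^sup>2) *\<^sub>C y)
       ((D z) *\<^sub>C y) z S"
      by (rule has_complex_derivative_scaleC_left)
    assume "\<bar>Im z\<bar> = N"
    then show "norm ((exp (z * of_real r) / (z - of_real \<sigma>)\<^sup>2) *\<^sub>C y) \<le> exp (a * r) * norm y / N\<^sup>2"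
      using abs_Im_le_cmod[of "z - of_real \<sigma>"] by (intro bound[OF z]) auto
  next
    fix z assume z: "z \<in> S" "Re z = a - N"
    then show "norm ((exp (z * of_real r) / (z - of_real \<sigma>)\<^sup>2) *\<^sub>C y) \<le> exp (a * r) * norm y / N\<^sup>2"
      using abs_Re_le_cmod[of "z - of_real \<sigma>"] assms by (intro bound[OF z(1)]) auto
  next
    show "continuous_on S (\<lambda>z. (D z) *\<^sub>C y)"
      unfolding D_def using S by (auto intro!: continuous_intros)
  qed (use assms in auto)
  also have "\<dots> = 4 * exp (a * r) * norm y / N"
    using \<open>N > 0\<close> by (simp add: power2_eq_square)
  finally show ?thesis .
qed

lemma has_integral_arctan:
  fixes d N :: real
  assumes "d > 0" "N \<ge> 0"
  shows "((\<lambda>\<xi>. 1 / (d\<^sup>2 + \<xi>\<^sup>2)) has_integral 2 * arctan (N / d) / d) {-N..N}"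
proof -
  have "((\<lambda>\<xi>. 1 / (d\<^sup>2 + \<xi>\<^sup>2)) has_integral arctan (N / d) / d - arctan (- N / d) / d) {-N..N}"
  proof (rule fundamental_theorem_of_calculus)
    fix \<xi> assume "\<xi> \<in> {-N..N}"
    have "((\<lambda>\<xi>. arctan (\<xi> / d) / d) has_real_derivative 1 / (d\<^sup>2 + \<xi>\<^sup>2)) (at \<xi> within {-N..N})"
    proof (rule DERIV_cong)
      show "((\<lambda>\<xi>. arctan (\<xi> / d) / d) has_real_derivative inverse (1 + (\<xi> / d)\<^sup>2) * (1 / d) / d) (at \<xi> within {-N..N})"
        using assms by (auto intro!: derivative_eq_intros)
      have "d\<^sup>2 + \<xi>\<^sup>2 > 0" "1 + (\<xi> / d)\<^sup>2 = (d\<^sup>2 + \<xi>\<^sup>2) / d\<^sup>2"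
        using \<open>d > 0\<close> zero_le_power2[of \<xi>] by (auto simp: field_simps add_pos_nonneg intro: add_nonneg_pos)
      then show "inverse (1 + (\<xi> / d)\<^sup>2) * (1 / d) / d = 1 / (d\<^sup>2 + \<xi>\<^sup>2)"
        using \<open>d > 0\<close> by (simp add: power2_eq_square)
    qed
    then show "((\<lambda>\<xi>. arctan (\<xi> / d) / d) has_vector_derivative 1 / (d\<^sup>2 + \<xi>\<^sup>2)) (at \<xi> within {-N..N})"
      by (simp add: has_real_derivative_iff_has_vector_derivative)
  qed (use assms in auto)
  then show ?thesis by (simp add: arctan_minus)
qed

context semigroup_resolvent_half_plane
begin

text \<open>
  The inversion integral of the Laplace transform for the orbit of \<open>(\<sigma> + A)\<^sup>-\<^sup>2 x\<close>, up to the factor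
  \<open>2 \<pi>\<close> and truncated at height \<open>N\<close>. Expanding the resolvent of that vector around \<open>\<sigma>\<close> yields two terms
  that contribute nothing to the inversion, since their only pole lies on the right, and the
  integrand below. The weight \<open>(z - \<sigma>)\<^sup>-\<^sup>2\<close> makes the integral converge absolutely.
\<close>

definition V :: "real \<Rightarrow> 'a \<Rightarrow> real \<Rightarrow> real \<Rightarrow> 'a" where
  "V \<sigma> x N t = integral {-N..N} (\<lambda>\<xi>. (exp (Complex a \<xi> * of_real t) / (Complex a \<xi> - of_real \<sigma>)\<^sup>2) *\<^sub>C R (Complex a \<xi>) x)"

lemma continuous_on_Complex: "continuous_on X (\<lambda>\<xi>. Complex b \<xi>)"
  by (auto simp: Complex_eq intro!: continuous_intros)

lemma line_neq_pole: "\<sigma> > a \<Longrightarrow> Complex a \<xi> \<noteq> of_real \<sigma>"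
  by (auto simp: complex_eq_iff)

lemma continuous_on_R_line: "continuous_on X (\<lambda>\<xi>. R (Complex a \<xi>) x)"
  by (rule continuous_on_compose2[OF continuous_on_R continuous_on_Complex]) auto

lemma continuous_on_V_integrand:
  assumes "\<sigma> > a"
  shows "continuous_on X (\<lambda>\<xi>. (exp (Complex a \<xi> * of_real t) / (Complex a \<xi> - of_real \<sigma>)\<^sup>2) *\<^sub>C R (Complex a \<xi>) x)"
  using line_neq_pole[OF assms] by (auto intro!: continuous_intros continuous_on_R_line continuous_on_Complex)

text \<open>
  By the interpolation identity, applied to each \<open>R z x\<close>, the difference is an integral over \<open>r\<close> of
  \<open>T (t - r) x\<close> with scalar weights; after exchanging the integrals, these weights are the integrals
  estimated in the previous lemmas and vanish as \<open>N\<close> grows. In the limit, \<open>V \<sigma> x N\<close> is thus an orbit of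
  the semigroup.
\<close>

lemma T_V_0_near_V:
  assumes "\<sigma> > a" "t \<ge> 0" "N > 0"
  shows "norm (V \<sigma> x N t - T t (V \<sigma> x N 0)) \<le> 4 * exp (\<bar>a\<bar> * t) * (K * exp (\<bar>w\<bar> * t) * norm x) / N * t"
proof -
  define k where "k \<xi> r = (exp (Complex a \<xi> * of_real r) / (Complex a \<xi> - of_real \<sigma>)\<^sup>2) *\<^sub>C T (t - r) x" for \<xi> r
  have contk: "continuous_on (cbox (-N, 0) (N, t)) (\<lambda>(\<xi>, r). k \<xi> r)"
    unfolding k_def case_prod_unfold
    by (intro continuous_intros continuous_on_compose2[OF continuous_on_orbit]
        continuous_on_compose2[OF continuous_on_Complex[of UNIV]])
       (use line_neq_pole[OF \<open>\<sigma> > a\<close>] in auto)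
  have inner: "integral {0..t} (k \<xi>) =
      (exp (Complex a \<xi> * of_real t) / (Complex a \<xi> - of_real \<sigma>)\<^sup>2) *\<^sub>C R (Complex a \<xi>) x -
      T t ((exp (Complex a \<xi> * of_real 0) / (Complex a \<xi> - of_real \<sigma>)\<^sup>2) *\<^sub>C R (Complex a \<xi>) x)" for \<xi>
  proof -
    note sol = op_inverse_solves[OF shift_onto_if_invertible[OF invertible[of "Complex a \<xi>"]], of x, folded R_def]
    have "((\<lambda>r. exp (Complex a \<xi> * of_real r) *\<^sub>C T (t - r) x) has_integral
        exp (Complex a \<xi> * of_real t) *\<^sub>C R (Complex a \<xi>) x - T t (R (Complex a \<xi>) x)) {0..t}"
      using exp_orbit_integral[OF sol(1) \<open>t \<ge> 0\<close>, of "Complex a \<xi>"] sol(2) by simp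
    then have "((\<lambda>r. (1 / (Complex a \<xi> - of_real \<sigma>)\<^sup>2) *\<^sub>C exp (Complex a \<xi> * of_real r) *\<^sub>C T (t - r) x) has_integral
       (1 / (Complex a \<xi> - of_real \<sigma>)\<^sup>2) *\<^sub>C (exp (Complex a \<xi> * of_real t) *\<^sub>C R (Complex a \<xi>) x - T t (R (Complex a \<xi>) x))) {0..t}"
      by (rule has_integral_linear[OF _ bounded_linear_scaleC_right, unfolded o_def])
    then show ?thesis
      using \<open>t \<ge> 0\<close> by (intro integral_unique) (simp add: k_def[abs_def] scaleC_scaleC scaleC_diff_right T_scaleC)
  qed
  define f where "f s \<xi> = (exp (Complex a \<xi> * of_real s) / (Complex a \<xi> - of_real \<sigma>)\<^sup>2) *\<^sub>C R (Complex a \<xi>) x" for s \<xi>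
  have int: "f s integrable_on {-N..N}" for s
    unfolding f_def by (intro integrable_continuous_interval continuous_on_V_integrand assms)
  have "V \<sigma> x N t - T t (V \<sigma> x N 0) = integral {-N..N} (f t) - integral {-N..N} (T t \<circ> f 0)"
    unfolding integral_linear[OF int bounded_linear_T[OF \<open>t \<ge> 0\<close>]] by (simp add: V_def f_def[abs_def])
  also have "\<dots> = integral {-N..N} (\<lambda>\<xi>. f t \<xi> - (T t \<circ> f 0) \<xi>)"
    by (intro integral_diff[symmetric] integrable_linear int bounded_linear_T \<open>t \<ge> 0\<close>)
  also have "\<dots> = integral {-N..N} (\<lambda>\<xi>. integral {0..t} (k \<xi>))"
    unfolding inner f_def o_def ..
  also have "\<dots> = integral {0..t} (\<lambda>r. integral {-N..N} (\<lambda>\<xi>. k \<xi> r))"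
    using integral_swap_continuous[OF contk] by simp
  also have "norm \<dots> \<le> 4 * exp (\<bar>a\<bar> * t) * (K * exp (\<bar>w\<bar> * t) * norm x) / N * (t - 0)"
  proof (rule integral_bound[OF \<open>t \<ge> 0\<close>])
    have "continuous_on (cbox 0 t) (\<lambda>r. integral (cbox (- N) N) (\<lambda>\<xi>. k \<xi> r))"
    proof (rule integral_continuous_on_param)
      have "continuous_on (cbox 0 t \<times> cbox (- N) N) (\<lambda>p. (\<lambda>(\<xi>, r). k \<xi> r) (snd p, fst p))"
        by (rule continuous_on_compose2[OF contk]) (auto intro!: continuous_intros)
      then show "continuous_on (cbox 0 t \<times> cbox (- N) N) (\<lambda>(r, \<xi>). k \<xi> r)"
        by (simp add: case_prod_unfold)
    qed
    then show "continuous_on {0..t} (\<lambda>r. integral {- N..N} (\<lambda>\<xi>. k \<xi> r))" by simp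
    fix r assume r: "r \<in> {0..t}"
    have "norm (integral {- N..N} (\<lambda>\<xi>. k \<xi> r)) \<le> 4 * exp (a * r) * norm (T (t - r) x) / N"
      unfolding k_def using assms r by (intro exp_pole_integral_bound) auto
    also have "a * r \<le> \<bar>a\<bar> * t"
      using r by (intro mult_mono) auto
    then have "4 * exp (a * r) * norm (T (t - r) x) / N \<le> 4 * exp (\<bar>a\<bar> * t) * (K * exp (\<bar>w\<bar> * t) * norm x) / N"
      using r \<open>N > 0\<close> by (intro divide_right_mono mult_mono norm_T_le_uniform) auto
    finally show "norm (integral {- N..N} (\<lambda>\<xi>. k \<xi> r)) \<le> 4 * exp (\<bar>a\<bar> * t) * (K * exp (\<bar>w\<bar> * t) * norm x) / N" .
  qed
  finally show ?thesis by simp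
qed

text \<open>
  On the line of integration \<open>\<bar>z - \<sigma>\<bar>\<^sup>2 = (\<sigma> - a)\<^sup>2 + \<xi>\<^sup>2\<close>, whose reciprocal has integral at most
  \<open>\<pi> / (\<sigma> - a)\<close>.
\<close>

lemma norm_V_le:
  assumes "\<sigma> > a" "N > 0"
  shows "norm (V \<sigma> x N t) \<le> exp (a * t) * G * norm x * (pi / (\<sigma> - a))"
proof -
  define d where "d = \<sigma> - a"
  have d: "d > 0" using assms by (simp add: d_def)
  note int = has_integral_mult_right[OF has_integral_arctan[OF d, of N], of "exp (a * t) * G * norm x"]
  have "norm (V \<sigma> x N t) \<le> integral {-N..N} (\<lambda>\<xi>. exp (a * t) * G * norm x * (1 / (d\<^sup>2 + \<xi>\<^sup>2)))"
    unfolding V_def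
  proof (rule integral_norm_bound_integral)
    show "(\<lambda>\<xi>. (exp (Complex a \<xi> * of_real t) / (Complex a \<xi> - of_real \<sigma>)\<^sup>2) *\<^sub>C R (Complex a \<xi>) x) integrable_on {-N..N}"
      by (intro integrable_continuous_interval continuous_on_V_integrand assms)
    show "(\<lambda>\<xi>. exp (a * t) * G * norm x * (1 / (d\<^sup>2 + \<xi>\<^sup>2))) integrable_on {-N..N}"
      using has_integral_integrable[OF int] assms by simp
    fix \<xi>
    have "(norm (Complex a \<xi> - of_real \<sigma>))\<^sup>2 = d\<^sup>2 + \<xi>\<^sup>2"
      by (simp add: cmod_power2 d_def power2_commute)
    then have "norm ((exp (Complex a \<xi> * of_real t) / (Complex a \<xi> - of_real \<sigma>)\<^sup>2) *\<^sub>C R (Complex a \<xi>) x) =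
        exp (a * t) * norm (R (Complex a \<xi>) x) * (1 / (d\<^sup>2 + \<xi>\<^sup>2))"
      by (simp add: norm_scaleC norm_divide norm_power norm_exp_eq_Re)
    also have "\<dots> \<le> exp (a * t) * (G * norm x) * (1 / (d\<^sup>2 + \<xi>\<^sup>2))"
      by (intro mult_right_mono mult_left_mono norm_R_le) auto
    finally show "norm ((exp (Complex a \<xi> * of_real t) / (Complex a \<xi> - of_real \<sigma>)\<^sup>2) *\<^sub>C R (Complex a \<xi>) x) \<le>
        exp (a * t) * G * norm x * (1 / (d\<^sup>2 + \<xi>\<^sup>2))" by (simp add: mult.assoc)
  qed
  also have "\<dots> = exp (a * t) * G * norm x * (2 * arctan (N / d) / d)"
    using integral_unique[OF int] assms by simp
  also have "\<dots> \<le> exp (a * t) * G * norm x * (pi / d)"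
    using arctan_ubound[of "N / d"] d G_nonneg by (intro mult_left_mono divide_right_mono) auto
  finally show ?thesis by (simp add: d_def)
qed

text \<open>
  The resolvent identity, used twice, separates the principal part at \<open>\<sigma>\<close> of \<open>R z x / (z - \<sigma>)\<^sup>2\<close> from
  the part that is holomorphic in the half-plane.
\<close>

lemma resolvent_expansion:
  assumes "Re z \<ge> a" "\<sigma> \<ge> a" "z \<noteq> of_real \<sigma>"
  defines "S \<equiv> R (of_real \<sigma>)" and "s \<equiv> z - of_real \<sigma>"
  shows "(1 / s\<^sup>2) *\<^sub>C R z x = (1 / s\<^sup>2) *\<^sub>C S x - (1 / s) *\<^sub>C S (S x) + R z (S (S x))"
proof -
  have s: "s \<noteq> 0" using assms by (simp add: s_def)
  have "R z y = S y - s *\<^sub>C R z (S y)" for y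
    using resolvent_identity[of "of_real \<sigma>" z y] assms by simp
  from this[of x] this[of "S x"] have "R z x = S x - s *\<^sub>C (S (S x) - s *\<^sub>C R z (S (S x)))"
    by simp
  then show ?thesis
    using s by (simp add: scaleC_diff_right scaleC_scaleC power2_eq_square)
qed

text \<open>
  The limit of \<open>V \<sigma> x N 0\<close> is \<open>2 \<pi> (\<sigma> + A)\<^sup>-\<^sup>2 x\<close>. In the expansion above the double pole contributes
  nothing in the limit. The simple pole and the holomorphic part both decay like \<open>1 / \<bar>z\<bar>\<close> only, which
  is too slow for a shift of the contour. Therefore \<open>u / (z - p)\<close> is subtracted from the holomorphic
  part and added to the simple pole, where \<open>p\<close> is the mirror image of \<open>\<sigma>\<close> in the line of integration.
  On the line the two simple poles then combine to an explicit multiple of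
  \<open>1 / ((\<sigma> - a)\<^sup>2 + \<xi>\<^sup>2)\<close>, whose integral is an arc tangent. The other difference, \<open>\<psi>\<close>, is
  holomorphic on the right of the line, and the expansion read backwards shows that it decays like
  \<open>1 / \<bar>z\<bar>\<^sup>2\<close>, so its integral vanishes in the limit when the contour is moved to the right.
\<close>

lemma V_0_near_square:
  fixes x :: 'a
  assumes "\<sigma> > a" "N > 0" "N \<ge> 2 * (\<sigma> - a)"
  defines "u \<equiv> R (of_real \<sigma>) (R (of_real \<sigma>) x)"
  shows "norm (V \<sigma> x N 0 - (4 * arctan (N / (\<sigma> - a))) *\<^sub>R u) \<le>
    (4 * norm (R (of_real \<sigma>) x) + 4 * (8 * G * norm x + 4 * (\<sigma> - a) * norm u)) / N"
proof -
  define d where "d = \<sigma> - a"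
  define p where "p = complex_of_real (a - d)"
  define v where "v = R (of_real \<sigma>) x"
  have uv: "R (of_real \<sigma>) v = u" by (simp add: u_def v_def)
  define \<psi> where "\<psi> z = R z u - (1 / (z - p)) *\<^sub>C u" for z
  define c where "c = (8 * G * norm x + 4 * d * norm u) / N\<^sup>2"
  define S where "S = {z. Re z \<in> closed_segment a (a + N) \<and> \<bar>Im z\<bar> \<le> N}"
  have d: "d > 0" "N \<ge> 2 * d" using assms by (auto simp: d_def)
  have S: "Re z \<ge> a \<and> z \<noteq> p" if "z \<in> S" for z
    using that assms d by (auto simp: S_def p_def closed_segment_eq_real_ivl)
  \<comment> \<open>Near \<open>\<sigma>\<close> the two summands in the proof are singular; the bound is only claimed away from it.\<close>
  have bound: "norm (\<psi> z) \<le> c"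
    if z: "Re z \<ge> a" "norm (z - of_real \<sigma>) \<ge> N / 2" "norm (z - p) \<ge> N" for z
  proof -
    have nz: "z - of_real \<sigma> \<noteq> 0" "z - p \<noteq> 0" using z assms(2) by auto
    have "\<psi> z = (1 / (z - of_real \<sigma>)\<^sup>2) *\<^sub>C (R z x - v) + (1 / (z - of_real \<sigma>) - 1 / (z - p)) *\<^sub>C u"
      using resolvent_expansion[of z \<sigma> x] z(1) nz assms(1) unfolding \<psi>_def
      by (simp add: scaleC_diff_right scaleC_diff_left add: uv flip: v_def)
    also have "1 / (z - of_real \<sigma>) - 1 / (z - p) = of_real (2 * d) / ((z - of_real \<sigma>) * (z - p))"
      using nz by (simp add: field_simps p_def d_def)
    finally have "norm (\<psi> z) \<le> 1 / (norm (z - of_real \<sigma>))\<^sup>2 * norm (R z x - v) +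
        2 * d / (norm (z - of_real \<sigma>) * norm (z - p)) * norm u"
      using norm_triangle_ineq[of "(1 / (z - of_real \<sigma>)\<^sup>2) *\<^sub>C (R z x - v)"
          "(of_real (2 * d) / ((z - of_real \<sigma>) * (z - p))) *\<^sub>C u"] d
      by (simp add: norm_scaleC norm_divide norm_power norm_mult)
    also have "\<dots> \<le> 1 / (N / 2)\<^sup>2 * (G * norm x + G * norm x) + 2 * d / (N / 2 * N) * norm u"
      using z assms(1,2) d unfolding v_def
      by (intro add_mono mult_mono divide_left_mono power_mono mult_pos_pos zero_less_power
          order_trans[OF norm_triangle_ineq4] norm_R_le) auto
    also have "\<dots> = c"
      using assms(2) by (simp add: c_def field_simps power2_eq_square)
    finally show ?thesis .
  qed
  have psi: "norm (integral {-N..N} (\<lambda>\<xi>. \<psi> (Complex a \<xi>))) \<le> 2 * c * (\<bar>(a + N) - a\<bar> + N)"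
  proof (rule vertical_integral_shift_bound[OF _ _ _ _ S_def, where f' = "\<lambda>z. - R z (R z u) - (- 1 / (z - p)\<^sup>2) *\<^sub>C u"])
    show "c \<ge> 0" using G_nonneg d by (simp add: c_def)
    fix z assume z: "z \<in> S"
    have "((\<lambda>z. 1 / (z - p)) has_field_derivative - 1 / (z - p)\<^sup>2) (at z within S)"
      using S[OF z] by (auto intro!: derivative_eq_intros simp: power2_eq_square)
    then show "has_complex_derivative \<psi> (- R z (R z u) - (- 1 / (z - p)\<^sup>2) *\<^sub>C u) z S"
      unfolding \<psi>_def using S z
      by (intro has_complex_derivative_diff has_complex_derivative_scaleC_left R_has_complex_derivative) auto
    have "norm (z - of_real \<sigma>) \<ge> \<bar>Im z\<bar>" "norm (z - p) \<ge> \<bar>Im z\<bar>"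
      using abs_Im_le_cmod[of "z - of_real \<sigma>"] abs_Im_le_cmod[of "z - p"] by (auto simp: p_def)
    then show "norm (\<psi> z) \<le> c" if "\<bar>Im z\<bar> = N"
      using S[OF z] that assms(2) by (intro bound) auto
    have "norm (z - of_real \<sigma>) \<ge> Re z - \<sigma>" "norm (z - p) \<ge> Re z - (a - d)"
      using abs_Re_le_cmod[of "z - of_real \<sigma>"] abs_Re_le_cmod[of "z - p"] by (auto simp: p_def)
    then show "norm (\<psi> z) \<le> c" if "Re z = a + N"
      using S[OF z] that assms(2) d by (intro bound) (auto simp: d_def)
  next
    show "continuous_on S (\<lambda>z. - R z (R z u) - (- 1 / (z - p)\<^sup>2) *\<^sub>C u)"
      using S by (auto intro!: continuous_intros continuous_on_subset[OF continuous_on_R_R])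
  qed (use assms in auto)
  define k where "k \<xi> = (exp (Complex a \<xi> * of_real 0) / (Complex a \<xi> - of_real \<sigma>)\<^sup>2) *\<^sub>C v" for \<xi>
  define h where "h \<xi> = (2 * d * (1 / (d\<^sup>2 + \<xi>\<^sup>2))) *\<^sub>R u" for \<xi>
  have split: "(exp (Complex a \<xi> * of_real 0) / (Complex a \<xi> - of_real \<sigma>)\<^sup>2) *\<^sub>C R (Complex a \<xi>) x =
      k \<xi> + (\<psi> (Complex a \<xi>) + h \<xi>)" for \<xi>
  proof -
    define s where "s = Complex a \<xi> - of_real \<sigma>"
    have nz: "s \<noteq> 0" "Complex a \<xi> - p \<noteq> 0"
      using assms(1) d by (auto simp: s_def p_def complex_eq_iff)
    have "s * (Complex a \<xi> - p) = - of_real (d\<^sup>2 + \<xi>\<^sup>2)"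
      by (simp add: complex_eq_iff s_def p_def d_def power2_eq_square algebra_simps)
    moreover have "1 / (Complex a \<xi> - p) - 1 / s = - of_real (2 * d) / (s * (Complex a \<xi> - p))"
      using nz by (simp add: field_simps s_def p_def d_def)
    ultimately have "1 / (Complex a \<xi> - p) - 1 / s = of_real (2 * d * (1 / (d\<^sup>2 + \<xi>\<^sup>2)))"
      by (simp only: minus_divide_divide of_real_divide[symmetric] times_divide_eq_right mult_1_right)
    then have h: "h \<xi> = (1 / (Complex a \<xi> - p)) *\<^sub>C u - (1 / s) *\<^sub>C u"
      unfolding h_def by (metis scaleC_diff_left scaleC_of_real)
    show ?thesis
      using resolvent_expansion[of "Complex a \<xi>" \<sigma> x] line_neq_pole[OF assms(1)] assms(1) unfolding h k_def \<psi>_def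
      by (simp add: uv flip: v_def s_def)
  qed
  have intk: "k integrable_on {-N..N}"
    unfolding k_def using line_neq_pole[OF assms(1)]
    by (auto intro!: integrable_continuous_interval continuous_intros continuous_on_Complex)
  have intpsi: "(\<lambda>\<xi>. \<psi> (Complex a \<xi>)) integrable_on {-N..N}"
  proof -
    have "Complex a \<xi> - p \<noteq> 0" for \<xi>
      using d by (auto simp: p_def complex_eq_iff)
    then show ?thesis
      unfolding \<psi>_def
      by (auto intro!: integrable_continuous_interval continuous_intros continuous_on_R_line continuous_on_Complex)
  qed
  have inth: "(h has_integral (4 * arctan (N / d)) *\<^sub>R u) {-N..N}"
    using has_integral_scaleR_left[OF has_integral_mult_right[OF has_integral_arctan[OF d(1)]], of N "2 * d" u] assms(2) d
    by (simp add: h_def[abs_def])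
  have "V \<sigma> x N 0 = integral {-N..N} k + (integral {-N..N} (\<lambda>\<xi>. \<psi> (Complex a \<xi>)) + integral {-N..N} h)"
    unfolding V_def split
    by (simp add: integral_add integrable_add intk intpsi has_integral_integrable[OF inth])
  then have "V \<sigma> x N 0 - (4 * arctan (N / d)) *\<^sub>R u = integral {-N..N} k + integral {-N..N} (\<lambda>\<xi>. \<psi> (Complex a \<xi>))"
    using integral_unique[OF inth] by simp
  also have "norm \<dots> \<le> 4 * exp (a * 0) * norm v / N + 2 * c * (\<bar>(a + N) - a\<bar> + N)"
    unfolding k_def using assms by (intro order_trans[OF norm_triangle_ineq] add_mono psi exp_pole_integral_bound) auto
  also have "\<dots> = (4 * norm v + 4 * (8 * G * norm x + 4 * d * norm u)) / N"
    using assms(2) by (simp add: c_def power2_eq_square field_simps)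
  finally show ?thesis by (simp add: d_def v_def)
qed

text \<open>
  The estimate that replaces the growth of the semigroup by the size of the resolvent: compare
  \<open>T t (V \<sigma> x N 0)\<close> with \<open>V \<sigma> x N t\<close> and let \<open>N\<close> tend to infinity.
\<close>

lemma norm_T_resolvent_square_le:
  assumes "\<sigma> > a" "t \<ge> 0"
  shows "norm (T t (R (of_real \<sigma>) (R (of_real \<sigma>) x))) \<le> exp (a * t) * G / (2 * (\<sigma> - a)) * norm x"
proof -
  define d where "d = \<sigma> - a"
  have d: "d > 0" using assms by (simp add: d_def)
  define u where "u = R (of_real \<sigma>) (R (of_real \<sigma>) x)"
  define B where "B = exp (a * t) * G * norm x * (pi / d)"
  define C1 where "C1 = 4 * exp (\<bar>a\<bar> * t) * (K * exp (\<bar>w\<bar> * t) * norm x) * t"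
  define C2 where "C2 = 4 * norm (R (of_real \<sigma>) x) + 4 * (8 * G * norm x + 4 * d * norm u)"
  define CT where "CT = K * exp (\<bar>w\<bar> * t)"
  have lin: "linear (T t)" by (rule bounded_linear.linear[OF bounded_linear_T[OF assms(2)]])
  have bound: "4 * arctan (N / d) * norm (T t u) \<le> B + (C1 / N + CT * (C2 / N))"
    if N: "N \<ge> max 1 (2 * d)" for N
  proof -
    have N': "N > 0" using N by simp
    have "4 * arctan (N / d) * norm (T t u) = norm (T t ((4 * arctan (N / d)) *\<^sub>R u))"
      using N' d by (simp add: linear_scale[OF lin])
    also have "T t ((4 * arctan (N / d)) *\<^sub>R u) = V \<sigma> x N t - (V \<sigma> x N t - T t (V \<sigma> x N 0)) -
        T t (V \<sigma> x N 0 - (4 * arctan (N / d)) *\<^sub>R u)"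
      by (simp add: linear_diff[OF lin])
    also have "norm \<dots> \<le> norm (V \<sigma> x N t) + norm (V \<sigma> x N t - T t (V \<sigma> x N 0)) +
        norm (T t (V \<sigma> x N 0 - (4 * arctan (N / d)) *\<^sub>R u))"
      by (intro order_trans[OF norm_triangle_ineq4] add_right_mono norm_triangle_ineq4)
    also have "\<dots> \<le> B + C1 / N + CT * (C2 / N)"
    proof (intro add_mono)
      show "norm (V \<sigma> x N t) \<le> B"
        using norm_V_le[OF assms(1) N'] by (simp add: B_def d_def)
      show "norm (V \<sigma> x N t - T t (V \<sigma> x N 0)) \<le> C1 / N"
        using T_V_0_near_V[OF assms N'] by (simp add: C1_def)
      have "norm (T t (V \<sigma> x N 0 - (4 * arctan (N / d)) *\<^sub>R u)) \<le> CT * norm (V \<sigma> x N 0 - (4 * arctan (N / d)) *\<^sub>R u)"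
        unfolding CT_def using assms by (intro norm_T_le_uniform) auto
      also have "\<dots> \<le> CT * (C2 / N)"
        using V_0_near_square[OF assms(1) N', of x] N K unfolding CT_def C2_def u_def d_def
        by (intro mult_left_mono) auto
      finally show "norm (T t (V \<sigma> x N 0 - (4 * arctan (N / d)) *\<^sub>R u)) \<le> CT * (C2 / N)" .
    qed
    finally show ?thesis by (simp add: add.assoc)
  qed
  have "filterlim (\<lambda>N. 1 / d * N) at_top at_top"
    using d by (intro filterlim_tendsto_pos_mult_at_top[OF tendsto_const] filterlim_ident) auto
  then have "((\<lambda>N. arctan (N / d)) \<longlongrightarrow> pi / 2) at_top"
    using filterlim_compose[OF tendsto_arctan_at_top] by simp
  then have lower: "((\<lambda>N. 4 * arctan (N / d) * norm (T t u)) \<longlongrightarrow> 4 * (pi / 2) * norm (T t u)) at_top"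
    by (intro tendsto_mult_right tendsto_mult_left)
  have upper: "((\<lambda>N. B + (C1 / N + CT * (C2 / N))) \<longlongrightarrow> B + (0 + CT * 0)) at_top"
    by (intro tendsto_add tendsto_const tendsto_mult tendsto_divide_0[OF tendsto_const]
        filterlim_at_top_imp_at_infinity filterlim_ident)
  have "4 * (pi / 2) * norm (T t u) \<le> B + (0 + CT * 0)"
    by (rule tendsto_le[OF trivial_limit_at_top_linorder upper lower])
       (rule eventually_mono[OF eventually_ge_at_top bound])
  then have "2 * pi * norm (T t u) \<le> 2 * pi * (exp (a * t) * G / (2 * d) * norm x)"
    by (simp add: B_def field_simps)
  then have "norm (T t u) \<le> exp (a * t) * G / (2 * d) * norm x"
    by (rule mult_left_le_imp_le) simp
  then show ?thesis
    by (simp add: u_def d_def)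
qed

end

section \<open>Fractional domains\<close>

text \<open>
  The integrand behaves like \<open>s\<^sup>n\<^sup>-\<^sup>\<gamma>\<^sup>-\<^sup>1\<close> near \<open>0\<close>, which is integrable since \<open>n > \<gamma>\<close>, and like \<open>s\<^sup>-\<^sup>\<gamma>\<close> at infinity,
  which is integrable precisely because \<open>\<gamma> > 1\<close>.
\<close>

lemma powr_integral_bound_exists:
  fixes \<gamma> :: real
  assumes "\<gamma> > 1"
  defines "n \<equiv> nat \<lfloor>\<gamma>\<rfloor> + 1"
  obtains h :: "real \<Rightarrow> real" where "h integrable_on {0<..}"
    "\<And>s. s > 0 \<Longrightarrow> s powr (real n - \<gamma> - 1) / (1 + s) ^ (n - 1) \<le> h s"
proof
  define h :: "real \<Rightarrow> real" where "h s = (if s \<le> 1 then s powr (real n - \<gamma> - 1) else s powr (- \<gamma>))" for s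
  have "real n = of_int \<lfloor>\<gamma>\<rfloor> + 1" using assms(1) by (simp add: n_def)
  then have n: "real n > \<gamma>" "n \<ge> 1"
    by linarith (simp add: n_def)
  have "h integrable_on {0..1}"
    by (rule integrable_eq[OF integrable_on_powr_from_0[of "real n - \<gamma> - 1" 1]]) (use n in \<open>auto simp: h_def\<close>)
  moreover have "h integrable_on {1..}"
    using has_integral_integrable[OF has_integral_powr_to_inf[of "-\<gamma>" 1]] assms
    by (rule_tac integrable_eq[where f = "\<lambda>s. s powr (-\<gamma>)"]) (auto simp: h_def)
  ultimately have "h integrable_on {0..}"
    by (rule integrable_Un') (auto simp: max_def)
  then show "h integrable_on {0<..}"
    by (rule integrable_spike_set) (auto intro: negligible_subset[of "{0}"])
  fix s :: real assume s: "s > 0"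
  show "s powr (real n - \<gamma> - 1) / (1 + s) ^ (n - 1) \<le> h s"
  proof (cases "s \<le> 1")
    case True
    have "s powr (real n - \<gamma> - 1) / (1 + s) ^ (n - 1) \<le> s powr (real n - \<gamma> - 1) / 1"
      using s by (intro divide_left_mono) auto
    with True show ?thesis by (simp add: h_def)
  next
    case False
    have "s powr (real n - \<gamma> - 1) / (1 + s) ^ (n - 1) \<le> s powr (real n - \<gamma> - 1) / s ^ (n - 1)"
      using s by (intro divide_left_mono power_mono mult_pos_pos zero_less_power) auto
    also have "s ^ (n - 1) = s powr (real n - 1)"
      using s n(2) by (simp add: of_nat_diff flip: powr_realpow)
    also have "s powr (real n - \<gamma> - 1) / s powr (real n - 1) = s powr (- \<gamma>)"
      by (simp flip: powr_diff)
    finally show ?thesis using False by (simp add: h_def)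
  qed
qed

context semigroup_generator
begin

lemma norm_op_inverse_power_le:
  assumes "shift_onto (of_real c) A" "c > w"
  shows "norm ((op_inverse (op_shift (of_real c) A) ^^ m) x) \<le> (K / (c - w)) ^ m * norm x"
proof (induction m)
  case (Suc m)
  have "norm ((op_inverse (op_shift (of_real c) A) ^^ Suc m) x) \<le>
      K / (c - w) * norm ((op_inverse (op_shift (of_real c) A) ^^ m) x)"
    using norm_op_inverse_le[OF assms] by simp
  also have "\<dots> \<le> K / (c - w) * ((K / (c - w)) ^ m * norm x)"
    using Suc.IH K assms(2) by (intro mult_left_mono) auto
  finally show ?case by simp
qed simp

end

context semigroup_resolvent_half_plane
begin

text \<open>
  This moves a squared resolvent from \<open>c\<close>, which may lie outside the half-plane, to the point
  \<open>c + p\<close> of the half-plane, at the price of the bounded factor \<open>(1 + p S)\<^sup>2\<close>. It is the resolvent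
  identity \<open>S = Q (1 + p S)\<close>, used twice.
\<close>

lemma op_inverse_square:
  assumes "shift_onto (of_real c) A" "c + p \<ge> a"
  defines "S \<equiv> op_inverse (op_shift (of_real c) A)" and "Q \<equiv> R (of_real (c + p))"
  shows "S (S x) = Q (Q (x + (2 * p) *\<^sub>R S x + p\<^sup>2 *\<^sub>R S (S x)))"
proof -
  have lin: "linear Q"
    using bounded_linear.linear[OF bounded_linear_R] assms(2) by (simp add: Q_def)
  have S: "S y = Q (y + p *\<^sub>R S y)" for y
  proof -
    note sol = op_inverse_solves[OF assms(1), of y, folded S_def]
    have "of_real (c + p) *\<^sub>C S y + the (A (S y)) = y + p *\<^sub>R S y"
      using sol(2) by (simp add: scaleC_of_real algebra_simps flip: of_real_add)
    then show ?thesis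
      using op_inverse_unique[OF invertible sol(1), of "of_real (c + p)"] assms(2)
      by (simp add: Q_def R_def del: of_real_add)
  qed
  have "S x + p *\<^sub>R S (S x) = Q (x + p *\<^sub>R S x) + p *\<^sub>R Q (S x + p *\<^sub>R S (S x))"
    using S by metis
  also have "\<dots> = Q (x + (2 * p) *\<^sub>R S x + p\<^sup>2 *\<^sub>R S (S x))"
    by (simp add: linear_add[OF lin] linear_scale[OF lin] algebra_simps power2_eq_square flip: scaleR_2)
  finally show ?thesis using S[of "S x"] by simp
qed

end

theorem proposition3p1:
  fixes T :: "real \<Rightarrow> 'a::complex_banach \<Rightarrow> 'a"
    and A :: "'a \<rightharpoonup> 'a"
    and g :: "real \<Rightarrow> real"
    and M \<omega> :: real
  assumes "\<exists>x::'a. x \<noteq> 0"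
    and "C0_semigroup T"
    and "op_uminus A = generator T"
    and "{z. Re z < 0} \<subseteq> resolvent_set A"
    and "M = (SUP t\<in>{0..2}. onorm (T t))"
    and "\<forall>s>0. g s > 0"
    and "mono_on {0<..} g"
    and "\<forall>z. Re z > 0 \<longrightarrow> onorm (op_inverse (op_shift z A)) \<le> g (inverse (Re z))"
    and "growth_bound T < ereal \<omega>"
  shows "\<forall>\<gamma>>1. \<exists>C>0. \<forall>t>0.
    onorm_dom (frac_power (op_shift (complex_of_real \<omega>) A) \<gamma>) (T t) \<le> C * g t + M"
proof (intro allI impI)
  fix \<gamma> :: real assume \<gamma>: "\<gamma> > 1"
  obtain w K where wK: "w < \<omega>" "K \<ge> 1" "\<And>t. t \<ge> 0 \<Longrightarrow> onorm (T t) \<le> K * exp (w * t)"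
    using assms(9) unfolding growth_bound_def Inf_less_iff by auto
  interpret semigroup_generator T A K w
    using assms(2,3) wK(2,3) by unfold_locales auto
  have inv: "op_invertible (op_shift z A)" if "Re z > 0" for z
  proof -
    have "- z \<in> resolvent_set A" using that assms(4) by auto
    then show ?thesis by (simp add: resolvent_set_def)
  qed
  have onto: "shift_onto (of_real c) A" if "c > w" for c :: real
    using shift_onto_right_of_growth[OF shift_onto_if_invertible[OF inv] that] by simp
  have M: "norm (T t x) \<le> M * norm x" if "0 \<le> t" "t \<le> 2" for t x
  proof -
    have "onorm (T s) \<le> K * exp (\<bar>w\<bar> * 2)" if "s \<in> {0..2}" for s
      using that K by (intro onorm_bound norm_T_le_uniform) auto
    then have "onorm (T t) \<le> M"
      unfolding assms(5) using that by (intro cSUP_upper) (auto intro!: bdd_aboveI2[of _ _ "K * exp (\<bar>w\<bar> * 2)"])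
    then show ?thesis
      using onorm[OF bounded_linear_T[OF that(1)], of x] mult_right_mono[of "onorm (T t)" M "norm x"] by simp
  qed
  have "M \<ge> 0" 
  proof -
    obtain x :: 'a where "x \<noteq> 0" using assms(1) by blast
    then show ?thesis using M[of 0 x] by (simp add: T_0)
  qed
  define B where "B = op_shift (of_real \<omega>) A"
  define n where "n = nat \<lfloor>\<gamma>\<rfloor> + 1"
  have n: "n \<ge> 2" using \<gamma> by (simp add: n_def le_nat_iff)
  define S where "S s = op_inverse (op_shift (complex_of_real s) B)" for s :: real
  have S_eq: "S s = op_inverse (op_shift (of_real (s + \<omega>)) A)" for s
    by (simp add: S_def B_def op_shift_op_shift)
  obtain h where h: "h integrable_on {0<..}"
    "\<And>s. s > 0 \<Longrightarrow> s powr (real n - \<gamma> - 1) / (1 + s) ^ (n - 1) \<le> h s"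
    using powr_integral_bound_exists[OF \<gamma>, folded n_def] by blast
  \<comment> \<open>With this choice \<open>s + \<omega> + p \<ge> s + 1\<close>, at distance at least \<open>s + 1 / 2\<close> from the line \<open>Re z = 1 / t\<close>
    when \<open>t > 2\<close>.\<close>
  define p where "p = \<bar>\<omega>\<bar> + 1"
  define \<delta> where "\<delta> = \<omega> - w"
  define L where "L = 1 + 2 * p * (K / \<delta>) + p\<^sup>2 * (K / \<delta>)\<^sup>2"
  define J where "J = (K * max 1 (1 / \<delta>)) ^ (n - 2)"
  define c where "c = Gamma (real n) / (Gamma \<gamma> * Gamma (real n - \<gamma>))"
  define C where "C = \<bar>c\<bar> * (exp 1 * L * J * integral {0<..} h) + 1"
  have \<delta>: "\<delta> > 0" using wK(1) by (simp add: \<delta>_def)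
  have p: "p > 0" by (simp add: p_def)
  have L: "L \<ge> 0" using K \<delta> p by (simp add: L_def)
  have J: "J \<ge> 0" using K \<delta> by (simp add: J_def)
  have int_h: "integral {0<..} h \<ge> 0"
    by (rule integral_nonneg[OF h(1)]) (use h(2) in \<open>force intro: order_trans[rotated]\<close>)
  then have C: "C > 0" using L J by (auto simp: C_def intro!: add_nonneg_pos mult_nonneg_nonneg)

  \<comment> \<open>Two of the \<open>n\<close> resolvents are spent on the transition from \<open>T t\<close> to \<open>g t\<close>, which yields one factor
    \<open>1 / (1 + s)\<close>; the other \<open>n - 2\<close> yield one such factor each.\<close>
  have decay: "norm (T t ((S s ^^ n) y)) \<le> exp 1 * g t * L * J / (1 + s) ^ (n - 1) * norm y"
    if t: "t > 2" and s: "s > 0" for t s y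
  proof -
    have g: "g t > 0" using assms(6) t by simp
    \<comment> \<open>The line \<open>Re z = 1 / t\<close> makes \<open>exp (Re z * t)\<close> the constant \<open>exp 1\<close> and the bound on the resolvent
      the value \<open>g t\<close>.\<close>
    interpret semigroup_resolvent_half_plane T A K w "1 / t" "g t"
    proof unfold_locales
      fix z assume z: "Re z \<ge> 1 / t"
      then have z': "Re z > 0" using t by (smt (verit) divide_pos_pos)
      then show "op_invertible (op_shift z A)" by (rule inv)
      have "inverse (Re z) \<le> t" using z z' t by (simp add: field_simps)
      then have "g (inverse (Re z)) \<le> g t"
        using z' t by (intro mono_onD[OF assms(7)]) auto
      then show "onorm (op_inverse (op_shift z A)) \<le> g t"
        using assms(8) z' by fastforce
    qed
    define y' where "y' = (S s ^^ (n - 2)) y"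
    define x where "x = y' + (2 * p) *\<^sub>R S s y' + p\<^sup>2 *\<^sub>R S s (S s y')"
    have onto': "shift_onto (of_real (s + \<omega>)) A" using s wK(1) by (intro onto) simp
    have c: "s + \<omega> > w" using s wK(1) by simp
    have a: "1 / t < 1 / 2" using t by (simp add: field_simps)
    have \<sigma>: "s + \<omega> + p \<ge> s + 1" by (simp add: p_def)
    have "(S s ^^ n) y = S s (S s y')"
      using n unfolding y'_def by (metis Suc_diff_le diff_Suc_Suc funpow.simps(2) comp_apply le_add_diff_inverse2 add_2_eq_Suc' numeral_2_eq_2)
    also have "\<dots> = R (of_real (s + \<omega> + p)) (R (of_real (s + \<omega> + p)) x)"
      unfolding S_eq x_def using a \<sigma> s by (intro op_inverse_square onto') simp
    finally have "norm (T t ((S s ^^ n) y)) \<le> exp (1 / t * t) * g t / (2 * (s + \<omega> + p - 1 / t)) * norm x"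
      using norm_T_resolvent_square_le[of "s + \<omega> + p" t x] a \<sigma> s t by simp
    also have "\<dots> \<le> exp 1 * g t / (1 + s) * (L * (J / (1 + s) ^ (n - 2) * norm y))"
    proof (intro mult_mono frac_le)
      show "1 + s \<le> 2 * (s + \<omega> + p - 1 / t)" using a \<sigma> s by argo
      have K\<delta>: "K / (s + \<omega> - w) \<le> K / \<delta>"
        using s wK(1) K by (intro divide_left_mono) (auto simp: \<delta>_def)
      have 1: "norm (S s z) \<le> K / \<delta> * norm z" for z
        using order_trans[OF norm_op_inverse_le[OF onto' c] mult_right_mono[OF K\<delta>]] by (simp add: S_eq)
      have 2: "norm (S s (S s z)) \<le> (K / \<delta>)\<^sup>2 * norm z" for z
        using order_trans[OF 1 mult_left_mono[OF 1]] K \<delta> by (simp add: power2_eq_square mult.assoc)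
      have "norm x \<le> norm y' + 2 * p * norm (S s y') + p\<^sup>2 * norm (S s (S s y'))"
        unfolding x_def using p by (intro order_trans[OF norm_triangle_ineq] add_mono) auto
      also have "\<dots> \<le> norm y' + 2 * p * (K / \<delta> * norm y') + p\<^sup>2 * ((K / \<delta>)\<^sup>2 * norm y')"
        using p by (intro add_mono mult_left_mono 1 2) auto
      also have "\<dots> = L * norm y'"
        by (simp add: L_def algebra_simps)
      also have "norm y' \<le> (K / (s + \<omega> - w)) ^ (n - 2) * norm y"
        unfolding y'_def S_eq by (rule norm_op_inverse_power_le[OF onto' c])
      also have "(K / (s + \<omega> - w)) ^ (n - 2) \<le> (K * max 1 (1 / \<delta>) / (1 + s)) ^ (n - 2)"
      proof (rule power_mono)
        have "1 + s \<le> max 1 (1 / \<delta>) * (s + \<delta>)"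
          using s \<delta> by (cases "\<delta> \<ge> 1") (auto simp: field_simps max_def)
        then have "K * (1 + s) \<le> K * (max 1 (1 / \<delta>) * (s + \<delta>))" 
          using K by (intro mult_left_mono) auto
        then show "K / (s + \<omega> - w) \<le> K * max 1 (1 / \<delta>) / (1 + s)"
          using s \<delta> by (simp add: field_simps \<delta>_def)
      qed (use K c in auto)
      also have "\<dots> = J / (1 + s) ^ (n - 2)"
        by (simp add: J_def power_divide)
      finally show "norm x \<le> L * (J / (1 + s) ^ (n - 2) * norm y)"
        using L by (simp add: mult_left_mono mult_right_mono)
    qed (use t g s in auto)
    also have "\<dots> = exp 1 * g t * L * J / ((1 + s) * (1 + s) ^ (n - 2)) * norm y"
      by simp
    also have "(1 + s) * (1 + s) ^ (n - 2) = (1 + s) ^ (n - 1)"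
      using n by (metis Suc_diff_le diff_Suc_Suc power_Suc numeral_2_eq_2 One_nat_def)
    finally show ?thesis .
  qed

  have range: "norm (T t (neg_frac_power B \<gamma> y)) \<le> C * g t * norm y" if t: "t > 2" for t y
  proof -
    have g: "g t > 0" using assms(6) t by simp
    define f where "f s = s powr (real n - \<gamma> - 1) *\<^sub>R (S s ^^ n) y" for s
    have neg: "neg_frac_power B \<gamma> y = c *\<^sub>R integral {0<..} f"
      by (simp add: neg_frac_power_def f_def[abs_def] n_def c_def S_def Let_def)
    have lin: "bounded_linear (T t)" using t by (intro bounded_linear_T) simp
    have "norm (T t (integral {0<..} f)) \<le> exp 1 * g t * L * J * norm y * integral {0<..} h"
    proof (cases "f integrable_on {0<..}")
      case True
      have "norm (integral {0<..} (T t \<circ> f)) \<le> integral {0<..} (\<lambda>s. exp 1 * g t * L * J * norm y * h s)"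
      proof (rule integral_norm_bound_integral)
        show "(T t \<circ> f) integrable_on {0<..}" by (rule integrable_linear[OF True lin])
        show "(\<lambda>s. exp 1 * g t * L * J * norm y * h s) integrable_on {0<..}"
          by (rule integrable_on_mult_right[OF h(1)])
        fix s :: real assume "s \<in> {0<..}"
        then have s: "s > 0" by simp
        have "norm ((T t \<circ> f) s) = s powr (real n - \<gamma> - 1) * norm (T t ((S s ^^ n) y))"
          by (simp add: f_def linear_scale[OF bounded_linear.linear[OF lin]])
        also have "\<dots> \<le> s powr (real n - \<gamma> - 1) * (exp 1 * g t * L * J / (1 + s) ^ (n - 1) * norm y)"
          by (intro mult_left_mono decay t s) simp
        also have "\<dots> = exp 1 * g t * L * J * norm y * (s powr (real n - \<gamma> - 1) / (1 + s) ^ (n - 1))"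
          by simp
        also have "\<dots> \<le> exp 1 * g t * L * J * norm y * h s"
          using g L J by (intro mult_left_mono h(2) s) auto
        finally show "norm ((T t \<circ> f) s) \<le> exp 1 * g t * L * J * norm y * h s" .
      qed
      then show ?thesis by (simp add: integral_linear[OF True lin])
    next
      \<comment> \<open>An integral that does not exist has the default value \<open>0\<close>.\<close>
      case False
      then show ?thesis
        using g L J int_h by (simp add: not_integrable_integral linear_0[OF bounded_linear.linear[OF lin]])
    qed
    then have "\<bar>c\<bar> * norm (T t (integral {0<..} f)) \<le> \<bar>c\<bar> * (exp 1 * g t * L * J * norm y * integral {0<..} h)"
      by (intro mult_left_mono) auto
    also have "\<dots> \<le> \<bar>c\<bar> * (exp 1 * g t * L * J * norm y * integral {0<..} h) + g t * norm y"
      using g by simp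
    also have "\<dots> = C * g t * norm y"
      by (simp add: C_def algebra_simps)
    finally show ?thesis
      by (simp add: neg linear_scale[OF bounded_linear.linear[OF lin]])
  qed

  have "onorm_dom (frac_power B \<gamma>) (T t) \<le> C * g t + M" if t: "t > 0" for t
    unfolding onorm_dom_def
  proof (rule cSUP_least)
    have "neg_frac_power B \<gamma> 0 \<in> dom (frac_power B \<gamma>)"
      by (auto simp: frac_power_def)
    then show "dom (frac_power B \<gamma>) \<noteq> {}" by blast
    fix x assume "x \<in> dom (frac_power B \<gamma>)"
    then have x: "x \<in> range (neg_frac_power B \<gamma>)"
      by (auto simp: frac_power_def split: if_splits)
    define y where "y = the (frac_power B \<gamma> x)"
    have xy: "x = neg_frac_power B \<gamma> y"
      using x by (simp add: y_def frac_power_def f_inv_into_f)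
    have g: "g t > 0" using assms(6) t by simp
    have norm_graph: "graph_norm (frac_power B \<gamma>) x = norm x + norm y"
      by (simp add: graph_norm_def y_def)
    have "norm (T t x) \<le> (C * g t + M) * (norm x + norm y)"
    proof (cases "t \<le> 2")
      case True
      have "norm (T t x) \<le> M * norm x" using M True t by simp
      also have "\<dots> \<le> (C * g t + M) * (norm x + norm y)"
        using C g \<open>M \<ge> 0\<close> by (intro mult_mono) auto
      finally show ?thesis .
    next
      case False
      then have "norm (T t x) \<le> C * g t * norm y" using range xy by simp
      also have "\<dots> \<le> (C * g t + M) * (norm x + norm y)"
        using C g \<open>M \<ge> 0\<close> by (intro mult_mono) auto
      finally show ?thesis .
    qed
    moreover have "norm x + norm y = 0 \<or> norm x + norm y > 0"
      using norm_ge_zero[of x] norm_ge_zero[of y] by linarith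
    ultimately show "norm (T t x) / graph_norm (frac_power B \<gamma>) x \<le> C * g t + M"
      unfolding norm_graph using C g \<open>M \<ge> 0\<close> by (auto simp: pos_divide_le_eq)
  qed
  with C show "\<exists>C>0. \<forall>t>0. onorm_dom (frac_power (op_shift (complex_of_real \<omega>) A) \<gamma>) (T t) \<le> C * g t + M"
    unfolding B_def by blast
qed

end
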